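(* Let $F=\langle K,v_1,v_2,\tau\rangle$ be a multi-weight-based sequential scrip bargaining with $k=|K|$ items and weight vectors $(w_j^1,\dots,w_j^q)$, $j\in K$. Then there is an equivalent bidding game with $|S|\le (k+1)\cdot M^2$ states, where $M=(w^1(K)+1)\times\cdots\times(w^q(K)+1)$ and $w^r(K)=\sum_{j\in K}w_j^r$. Further, such a bidding game can be constructed efficiently (in time polynomial in $k$ and $M$).
   Context: A (two-player) sequential scrip bargaining (SSB) is $F=\langle K,v_1,v_2,\tau\rangle$, where $K$ is a finite set of $k$ items, $v_i:2^K\to\mathbb R$ is the value function of agent $i\in\{1,2\}$, and $\tau$ is a permutation of $K$ giving the order in which items are offered. Agents hold budgets $B_1,B_2$ with $B_1+B_2=1$. In each turn they simultaneously bid at most their current budgets for the current item; the higher bidder wins (agent 1 wins ties), pays her bid to the other agent, and decides which of the two agents gets the item. Budgets have no value outside the game: at final allocation $(K^1,K^2)$ agent $i$'s utility is $v_i(K^i)$. $F$ is multi-weight-based if every item $j\in K$ has a vector of fixed nonnegative integer weights $(w_j^1,\dots,w_j^q)$ and for each agent $i$ there is an arbitrary function $f_i:\mathbb N^q\to\mathbb R$ with $v_i(A)=f_i\bigl(\sum_{j\in A}w_j^1,\dots,\sum_{j\in A}w_j^q\bigr)$ for all $A\subseteq K$. A game structure is $G=\langle S,s_0,T,g,u_1,u_2\rangle$ with finite state set $S$, initial state $s_0$, terminals $T\subseteq S$, a move function $g$ assigning to each $s\in S\setminus T$ a nonempty set of next states available to both players (acyclic; a directed acyclic graph is allowed), and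 $u_i:T\to\mathbb R$. In the corresponding bidding game with resolution $\varepsilon$ (budgets and bids are multiples of $\varepsilon$), at each nonterminal state $s$ players simultaneously bid at most their budgets and select a next state in $g(s)$; the higher bidder (player 1 in ties) pays her bid to the other player and her selected state is played; utilities are $u_i$ at the terminal reached. Two such games are equivalent if, for any resolution $\varepsilon$, there is a one-to-one mapping between strategy profiles in the original and the induced game that preserves utilities.
   Formalization: If there are items but all weights are zero (M=1, k>0), the bound (k+1)M² is false and 2k+1 states is proved instead; the running time carries an extra factor q+1, needed when some w^r(K)=0 (otherwise q ≤ log2 M). *)

theory Defs
  imports Complex_Main "HOL-Library.FuncSet"
begin

section \<open>Two-player bidding over a sequence of public choices\<close>

datatype player = P1 | P2

text \<open>
  Sequential scrip bargaining and bidding games on game structures share the same bidding rules and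
  differ only in what the winner of a round chooses (a recipient, respectively a next state).
  A process gives, for the sequence of choices implemented so far, the currently available choices
  (the empty set meaning that play is over) and the final payoffs.
\<close>

record 'm process =
  choices :: "'m list \<Rightarrow> 'm set"
  payoff :: "player \<Rightarrow> 'm list \<Rightarrow> real"

text \<open>A public history lists, oldest round first, the bids of both players and the choice that was
  implemented.  The choice submitted by the losing bidder is not recorded.\<close>

type_synonym 'm history = "((player \<Rightarrow> real) \<times> 'm) list"

type_synonym 'm strategy = "'m history \<Rightarrow> real \<times> 'm"

definition winner :: "(player \<Rightarrow> real) \<Rightarrow> player" where
  "winner b = (if b P2 \<le> b P1 then P1 else P2)"

definition transfer :: "(player \<Rightarrow> real) \<Rightarrow> (player \<Rightarrow> real) \<Rightarrow> player \<Rightarrow> real" where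
  "transfer B b i = (if i = winner b then B i - b i else B i + b (winner b))"

definition budget_after :: "(player \<Rightarrow> real) \<Rightarrow> 'm history \<Rightarrow> player \<Rightarrow> real" where
  "budget_after B h = foldl (\<lambda>B' (b, m). transfer B' b) B h"

definition bids :: "real \<Rightarrow> real \<Rightarrow> real set" where
  "bids \<epsilon> c = {x. \<exists>n::nat. x = real n * \<epsilon> \<and> x \<le> c}"

definition available :: "'m process \<Rightarrow> 'm history \<Rightarrow> 'm set" where
  "available P h = choices P (map snd h)"

inductive_set histories :: "'m process \<Rightarrow> real \<Rightarrow> (player \<Rightarrow> real) \<Rightarrow> 'm history set"
  for P :: "'m process" and \<epsilon> :: real and B :: "player \<Rightarrow> real" where
  start: "[] \<in> histories P \<epsilon> B"
| extend: "\<lbrakk>h \<in> histories P \<epsilon> B; \<And>i. b i \<in> bids \<epsilon> (budget_after B h i); m \<in> available P h\<rbrakk>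
    \<Longrightarrow> h @ [(b, m)] \<in> histories P \<epsilon> B"

definition decision_points :: "'m process \<Rightarrow> real \<Rightarrow> (player \<Rightarrow> real) \<Rightarrow> 'm history set" where
  "decision_points P \<epsilon> B = {h \<in> histories P \<epsilon> B. available P h \<noteq> {}}"

text \<open>Extensional function spaces are essential here: two strategies are the same object iff they
  agree at all decision points, so that bijections between strategy sets are meaningful.\<close>

definition strategies :: "'m process \<Rightarrow> real \<Rightarrow> (player \<Rightarrow> real) \<Rightarrow> player \<Rightarrow> 'm strategy set" where
  "strategies P \<epsilon> B i =
     (\<Pi>\<^sub>E h\<in>decision_points P \<epsilon> B. bids \<epsilon> (budget_after B h i) \<times> available P h)"

definition profiles :: "'m process \<Rightarrow> real \<Rightarrow> (player \<Rightarrow> real) \<Rightarrow> (player \<Rightarrow> 'm strategy) set" where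
  "profiles P \<epsilon> B = {\<sigma>. \<forall>i. \<sigma> i \<in> strategies P \<epsilon> B i}"

definition next_round :: "(player \<Rightarrow> 'm strategy) \<Rightarrow> 'm history \<Rightarrow> (player \<Rightarrow> real) \<times> 'm" where
  "next_round \<sigma> h = (let b = (\<lambda>i. fst (\<sigma> i h)) in (b, snd (\<sigma> (winner b) h)))"

primrec play :: "'m process \<Rightarrow> (player \<Rightarrow> 'm strategy) \<Rightarrow> nat \<Rightarrow> 'm history" where
  "play P \<sigma> 0 = []"
| "play P \<sigma> (Suc n) = play P \<sigma> n @ [next_round \<sigma> (play P \<sigma> n)]"

definition outcome :: "'m process \<Rightarrow> (player \<Rightarrow> 'm strategy) \<Rightarrow> 'm history" where
  "outcome P \<sigma> = play P \<sigma> (LEAST n. available P (play P \<sigma> n) = {})"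

definition utility :: "'m process \<Rightarrow> (player \<Rightarrow> 'm strategy) \<Rightarrow> player \<Rightarrow> real" where
  "utility P \<sigma> i = payoff P i (map snd (outcome P \<sigma>))"

definition budgets_ok :: "real \<Rightarrow> (player \<Rightarrow> real) \<Rightarrow> bool" where
  "budgets_ok \<epsilon> B \<longleftrightarrow> (\<forall>i. \<exists>n::nat. B i = real n * \<epsilon>) \<and> B P1 + B P2 = 1"

text \<open>The one-to-one mapping between strategy profiles is required to act on each player's strategies
  separately, so that it is an isomorphism of games and in particular preserves equilibria; the induced
  map on profiles is a bijection (lemma \<open>equivalent_profiles\<close>).\<close>

definition equivalent :: "'m process \<Rightarrow> 'n process \<Rightarrow> bool" where
  "equivalent P Q \<longleftrightarrow>
     (\<forall>\<epsilon> B. \<epsilon> > 0 \<and> budgets_ok \<epsilon> B \<longrightarrow>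
        (\<exists>\<phi> :: player \<Rightarrow> 'm strategy \<Rightarrow> 'n strategy.
           (\<forall>i. bij_betw (\<phi> i) (strategies P \<epsilon> B i) (strategies Q \<epsilon> B i)) \<and>
           (\<forall>\<sigma>\<in>profiles P \<epsilon> B. \<forall>i. utility Q (\<lambda>j. \<phi> j (\<sigma> j)) i = utility P \<sigma> i)))"

lemma equivalent_profiles:
  fixes P :: "'m process" and Q :: "'n process"
  assumes "equivalent P Q" and "\<epsilon> > 0" and "budgets_ok \<epsilon> B"
  shows "\<exists>\<Phi>. bij_betw \<Phi> (profiles P \<epsilon> B) (profiles Q \<epsilon> B) \<and>
           (\<forall>\<sigma>\<in>profiles P \<epsilon> B. utility Q (\<Phi> \<sigma>) = utility P \<sigma>)"
proof -
  obtain \<phi> :: "player \<Rightarrow> 'm strategy \<Rightarrow> 'n strategy"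
    where bij: "\<And>i. bij_betw (\<phi> i) (strategies P \<epsilon> B i) (strategies Q \<epsilon> B i)"
      and ut: "\<And>\<sigma> i. \<sigma> \<in> profiles P \<epsilon> B \<Longrightarrow> utility Q (\<lambda>j. \<phi> j (\<sigma> j)) i = utility P \<sigma> i"
    using assms unfolding equivalent_def by metis
  define \<psi> where "\<psi> = (\<lambda>i. inv_into (strategies P \<epsilon> B i) (\<phi> i))"
  have \<psi>: "\<psi> i y \<in> strategies P \<epsilon> B i" "\<phi> i (\<psi> i y) = y" if "y \<in> strategies Q \<epsilon> B i" for i y
    using bij_betwE[OF bij_betw_inv_into[OF bij[of i]]] bij_betw_inv_into_right[OF bij[of i]] that
    by (auto simp: \<psi>_def)
  have \<phi>: "\<phi> i x \<in> strategies Q \<epsilon> B i" "\<psi> i (\<phi> i x) = x" if "x \<in> strategies P \<epsilon> B i" for i x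
    using bij_betwE[OF bij[of i]] bij_betw_inv_into_left[OF bij[of i]] that
    by (auto simp: \<psi>_def)
  have "bij_betw (\<lambda>\<sigma> i. \<phi> i (\<sigma> i)) (profiles P \<epsilon> B) (profiles Q \<epsilon> B)"
    by (rule bij_betw_byWitness[where f' = "\<lambda>\<sigma> i. \<psi> i (\<sigma> i)"])
      (auto simp: profiles_def \<phi> \<psi>)
  with ut show ?thesis by (auto intro!: exI[of _ "\<lambda>\<sigma> i. \<phi> i (\<sigma> i)"])
qed


section \<open>Bidding games on game structures\<close>

record 's game_structure =
  states :: "'s set"
  init :: 's
  terminals :: "'s set"
  moves :: "'s \<Rightarrow> 's set"
  util :: "player \<Rightarrow> 's \<Rightarrow> real"

definition game_structure :: "'s game_structure \<Rightarrow> bool" where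
  "game_structure G \<longleftrightarrow>
     finite (states G) \<and> init G \<in> states G \<and> terminals G \<subseteq> states G \<and>
     (\<forall>s \<in> states G - terminals G. moves G s \<noteq> {} \<and> moves G s \<subseteq> states G) \<and>
     acyclic {(s, s'). s \<in> states G - terminals G \<and> s' \<in> moves G s}"

definition bidding_game :: "'s game_structure \<Rightarrow> 's process" where
  "bidding_game G = \<lparr>
     choices = (\<lambda>ss. let s = last (init G # ss) in if s \<in> terminals G then {} else moves G s),
     payoff = (\<lambda>i ss. util G i (last (init G # ss))) \<rparr>"


section \<open>Sequential scrip bargaining\<close>

record 'a bargaining =
  items :: "'a set"
  valuation :: "player \<Rightarrow> 'a set \<Rightarrow> real"
  item_order :: "'a list"

definition ssb :: "'a bargaining \<Rightarrow> bool" where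
  "ssb F \<longleftrightarrow> finite (items F) \<and> distinct (item_order F) \<and> set (item_order F) = items F"

text \<open>In the bargaining process a choice is the recipient of the current item.  As in bidding games,
  a player submits her intended recipient together with her bid, and it takes effect if she wins.
  \<open>cs\<close> lists the recipients of the items in the order in which they were offered.\<close>

definition allotment :: "'a bargaining \<Rightarrow> player list \<Rightarrow> player \<Rightarrow> 'a set" where
  "allotment F cs i = {item_order F ! t | t. t < length (item_order F) \<and> cs ! t = i}"

definition ssb_process :: "'a bargaining \<Rightarrow> player process" where
  "ssb_process F = \<lparr>
     choices = (\<lambda>cs. if length cs < length (item_order F) then UNIV else {}),
     payoff = (\<lambda>i cs. valuation F i (allotment F cs i)) \<rparr>"

definition weight_vector :: "nat \<Rightarrow> ('a \<Rightarrow> nat \<Rightarrow> nat) \<Rightarrow> 'a set \<Rightarrow> nat list" where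
  "weight_vector q w A = map (\<lambda>r. \<Sum>j\<in>A. w j r) [0..<q]"

definition multi_weight_based ::
    "'a bargaining \<Rightarrow> nat \<Rightarrow> ('a \<Rightarrow> nat \<Rightarrow> nat) \<Rightarrow> (player \<Rightarrow> nat list \<Rightarrow> real) \<Rightarrow> bool" where
  "multi_weight_based F q w f \<longleftrightarrow>
     (\<forall>i. \<forall>A \<subseteq> items F. valuation F i A = f i (weight_vector q w A))"

text \<open>
  This is \<open>M\<close>.  The bound \<open>(k + 1) * M\<^sup>2\<close> on the number of states fails if all weights are zero but
  there are items (\<open>M = 1\<close>, \<open>k > 0\<close>): already for \<open>k = 1\<close> it leaves at most one possible
  next state at the initial state, whereas the winner in the bargaining has two options, so for every
  resolution the bargaining has more strategy profiles.  That case therefore needs a separate bound.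
\<close>

definition weight_bound :: "'a bargaining \<Rightarrow> nat \<Rightarrow> ('a \<Rightarrow> nat \<Rightarrow> nat) \<Rightarrow> nat" where
  "weight_bound F q w = (\<Prod>r<q. (\<Sum>j\<in>items F. w j r) + 1)"


section \<open>Model of computation\<close>

text \<open>
  Unit-cost random access programs with arrays of natural numbers.  There is no multiplication, so that
  the number of bits of stored values grows at most linearly with running time.  The functions
  \<open>f\<^sub>1, f\<^sub>2\<close> are arbitrary real functions and hence available only as black boxes:
  \<open>Query i e a e'\<close> evaluates \<open>f\<^sub>i\<close> at the first \<open>e'\<close> entries of array \<open>a\<close> and
  stores the answer at index \<open>e\<close> of the real-valued table for player \<open>i\<close>.
\<close>

type_synonym name = string

datatype exp = Num nat | Reg name | Get name exp | Add exp exp | Sub exp exp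

datatype com =
    Assign name exp
  | Put name exp exp
  | Query player exp name exp
  | Seq com com
  | IfLess exp exp com com
  | WhileLess exp exp com

record store =
  reg :: "name \<Rightarrow> nat"
  arr :: "name \<Rightarrow> nat \<Rightarrow> nat"
  tab :: "player \<Rightarrow> nat \<Rightarrow> real"

primrec ev :: "exp \<Rightarrow> store \<Rightarrow> nat" where
  "ev (Num n) s = n"
| "ev (Reg x) s = reg s x"
| "ev (Get a e) s = arr s a (ev e s)"
| "ev (Add e e') s = ev e s + ev e' s"
| "ev (Sub e e') s = ev e s - ev e' s"

primrec cost :: "exp \<Rightarrow> nat" where
  "cost (Num n) = 1"
| "cost (Reg x) = 1"
| "cost (Get a e) = 1 + cost e"
| "cost (Add e e') = 1 + cost e + cost e'"
| "cost (Sub e e') = 1 + cost e + cost e'"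

text \<open>\<open>exec f c s n s'\<close>: with black boxes \<open>f\<close>, program \<open>c\<close> started in \<open>s\<close>
  halts in \<open>s'\<close> after \<open>n\<close> elementary steps.\<close>

inductive exec ::
    "(player \<Rightarrow> nat list \<Rightarrow> real) \<Rightarrow> com \<Rightarrow> store \<Rightarrow> nat \<Rightarrow> store \<Rightarrow> bool"
  for f :: "player \<Rightarrow> nat list \<Rightarrow> real" where
  Assign: "exec f (Assign x e) s (1 + cost e) (s\<lparr>reg := (reg s)(x := ev e s)\<rparr>)"
| Put: "exec f (Put a e e') s (1 + cost e + cost e')
     (s\<lparr>arr := (arr s)(a := (arr s a)(ev e s := ev e' s))\<rparr>)"
| Query: "exec f (Query i e a e') s (1 + cost e + cost e' + ev e' s)
     (s\<lparr>tab := (tab s)(i := (tab s i)(ev e s := f i (map (arr s a) [0..<ev e' s])))\<rparr>)"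
| Seq: "\<lbrakk>exec f c s n s'; exec f c' s' n' s''\<rbrakk> \<Longrightarrow> exec f (Seq c c') s (n + n') s''"
| IfTrue: "\<lbrakk>ev e s < ev e' s; exec f c s n s'\<rbrakk>
     \<Longrightarrow> exec f (IfLess e e' c c') s (1 + cost e + cost e' + n) s'"
| IfFalse: "\<lbrakk>\<not> ev e s < ev e' s; exec f c' s n s'\<rbrakk>
     \<Longrightarrow> exec f (IfLess e e' c c') s (1 + cost e + cost e' + n) s'"
| WhileFalse: "\<not> ev e s < ev e' s \<Longrightarrow> exec f (WhileLess e e' c) s (1 + cost e + cost e') s"
| WhileTrue: "\<lbrakk>ev e s < ev e' s; exec f c s n s'; exec f (WhileLess e e' c) s' n' s''\<rbrakk>
     \<Longrightarrow> exec f (WhileLess e e' c) s (1 + cost e + cost e' + n + n') s''"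

inductive_cases AssignE: "exec f (Assign x e) s n s'"
inductive_cases PutE: "exec f (Put a e e') s n s'"
inductive_cases QueryE: "exec f (Query i e a e') s n s'"
inductive_cases SeqE: "exec f (Seq c c') s n s'"
inductive_cases IfE: "exec f (IfLess e e' c c') s n s'"
inductive_cases WhileE: "exec f (WhileLess e e' c) s n s'"

lemma exec_deterministic:
  "exec f c s n s' \<Longrightarrow> exec f c s m t \<Longrightarrow> m = n \<and> t = s'"
proof (induction arbitrary: m t rule: exec.induct)
  case Assign
  then show ?case by (elim AssignE) simp
next
  case Put
  then show ?case by (elim PutE) simp
next
  case Query
  then show ?case by (elim QueryE) simp
next
  case Seq
  from Seq.prems show ?case by (rule SeqE) (metis Seq.IH)
next
  case IfTrue
  from IfTrue.prems show ?case by (rule IfE) (auto dest!: IfTrue.IH simp: IfTrue.hyps(1))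
next
  case IfFalse
  from IfFalse.prems show ?case by (rule IfE) (auto dest!: IfFalse.IH simp: IfFalse.hyps(1))
next
  case WhileFalse
  from WhileFalse.prems show ?case by (rule WhileE) (use WhileFalse.hyps in simp_all)
next
  case WhileTrue
  from WhileTrue.prems show ?case by (rule WhileE) (auto dest!: WhileTrue.IH simp: WhileTrue.hyps(1))
qed

text \<open>Input: the items are numbered by their position in an arbitrary enumeration \<open>xs\<close>; the weights
  are stored row by row, and \<open>''order''\<close> holds the numbers of the items as they are offered.\<close>

definition input_store :: "'a bargaining \<Rightarrow> nat \<Rightarrow> ('a \<Rightarrow> nat \<Rightarrow> nat) \<Rightarrow> 'a list \<Rightarrow> store" where
  "input_store F q w xs = \<lparr>
     reg = (\<lambda>_. 0)(''k'' := card (items F), ''q'' := q),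
     arr = (\<lambda>_ _. 0)(
       ''w'' := (\<lambda>m. if m < card (items F) * q then w (xs ! (m div q)) (m mod q) else 0),
       ''order'' := (\<lambda>t. if t < card (items F)
          then (THE j. j < length xs \<and> xs ! j = item_order F ! t) else 0)),
     tab = (\<lambda>_ _. 0) \<rparr>"

text \<open>Output: adjacency lists over the states \<open>0, \<dots>, n - 1\<close>; the terminals are the states without
  successors.\<close>

definition output_game :: "store \<Rightarrow> nat game_structure" where
  "output_game s = \<lparr>
     states = {..<reg s ''n''},
     init = reg s ''init'',
     terminals = {x. x < reg s ''n'' \<and> arr s ''deg'' x = 0},
     moves = (\<lambda>x. {arr s ''succ'' (arr s ''off'' x + m) | m. m < arr s ''deg'' x}),
     util = tab s \<rparr>"

end

theory Submission
  imports Defs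
begin

text \<open>
  Read a weight vector as a number in the mixed radix with digit bounds \<open>w\<^sup>r(K)\<close>. This code is
  additive on disjoint item sets and takes values below \<open>M\<close>, so the weights reduce to a single weight
  per item whose total is \<open>M - 1\<close>. After \<open>t\<close> rounds the payoffs depend only on the code of player
  1's items, as player 2's code is its complement. Since an item of weight zero must still lead to two
  different states, the recipient of the last item is remembered too. This gives \<open>2M\<close> states in
  each round and one initial state, and \<open>2kM + 1 \<le> (k + 1)M\<^sup>2\<close> unless \<open>M = 1\<close> and
  \<open>k > 0\<close>. The games are equivalent since a sequence of recipients and the path of states that it
  produces determine each other.
\<close>

section \<open>Equivalence by unfolding a game structure\<close>

text \<open>Choice sequences that can occur when bids are ignored. Conditions stated on them serve
  every resolution and all initial budgets at once.\<close>

inductive feasible :: "'m process \<Rightarrow> 'm list \<Rightarrow> bool" for P where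
  feasible_Nil: "feasible P []"
| feasible_snoc: "feasible P cs \<Longrightarrow> m \<in> choices P cs \<Longrightarrow> feasible P (cs @ [m])"

lemma histories_feasible: "h \<in> histories P \<epsilon> B \<Longrightarrow> feasible P (map snd h)"
  by (induction rule: histories.induct) (auto simp: available_def intro: feasible.intros)

text \<open>Dependent functions are transported along a bijection \<open>f\<close> of the index sets
  and bijections \<open>g x\<close> of the fibres. This turns matching decision points and matching
  options into matching strategies.\<close>

lemma bij_betw_PiE:
  assumes f: "bij_betw f A A'" and g: "\<And>x. x \<in> A \<Longrightarrow> bij_betw (g x) (C x) (C' (f x))"
  shows "bij_betw (\<lambda>\<sigma>. \<lambda>y\<in>A'. g (inv_into A f y) (\<sigma> (inv_into A f y))) (Pi\<^sub>E A C) (Pi\<^sub>E A' C')"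
proof (rule bij_betw_byWitness[where f' = "\<lambda>\<tau>. \<lambda>x\<in>A. inv_into (C x) (g x) (\<tau> (f x))"])
  have fA: "f x \<in> A'" "inv_into A f (f x) = x" if "x \<in> A" for x
    using f that by (auto simp: bij_betw_def)
  have fA': "inv_into A f y \<in> A" "f (inv_into A f y) = y" if "y \<in> A'" for y
    using f that by (auto simp: bij_betw_def inv_into_into f_inv_into_f)
  have gC: "g x u \<in> C' (f x)" "inv_into (C x) (g x) (g x u) = u" if "x \<in> A" "u \<in> C x" for x u
    using g[OF that(1)] that by (auto simp: bij_betw_def)
  have gC': "inv_into (C x) (g x) u \<in> C x" "g x (inv_into (C x) (g x) u) = u"
    if "x \<in> A" "u \<in> C' (f x)" for x u
    using g[OF that(1)] that by (auto simp: bij_betw_def inv_into_into f_inv_into_f)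
  show "\<forall>\<sigma>\<in>Pi\<^sub>E A C. (\<lambda>x\<in>A. inv_into (C x) (g x)
      ((\<lambda>y\<in>A'. g (inv_into A f y) (\<sigma> (inv_into A f y))) (f x))) = \<sigma>"
    by (auto simp: fA gC PiE_iff intro!: extensionalityI[of _ A])
  show "\<forall>\<tau>\<in>Pi\<^sub>E A' C'. (\<lambda>y\<in>A'. g (inv_into A f y)
      ((\<lambda>x\<in>A. inv_into (C x) (g x) (\<tau> (f x))) (inv_into A f y))) = \<tau>"
  proof (intro ballI extensionalityI[of _ A'])
    fix \<tau> y assume \<tau>: "\<tau> \<in> Pi\<^sub>E A' C'" and y: "y \<in> A'"
    then have "\<tau> y \<in> C' (f (inv_into A f y))" by (simp add: fA' PiE_mem)
    with y show "(\<lambda>y\<in>A'. g (inv_into A f y)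
      ((\<lambda>x\<in>A. inv_into (C x) (g x) (\<tau> (f x))) (inv_into A f y))) y = \<tau> y"
      by (simp add: fA' gC')
  qed (auto simp: PiE_iff)
  have "g (inv_into A f y) (\<sigma> (inv_into A f y)) \<in> C' y"
    if "\<sigma> \<in> Pi\<^sub>E A C" "y \<in> A'" for \<sigma> y
    using gC(1)[of "inv_into A f y" "\<sigma> (inv_into A f y)"] that by (simp add: fA' PiE_mem)
  then show "(\<lambda>\<sigma>. \<lambda>y\<in>A'. g (inv_into A f y) (\<sigma> (inv_into A f y))) ` Pi\<^sub>E A C \<subseteq> Pi\<^sub>E A' C'"
    by auto
  show "(\<lambda>\<tau>. \<lambda>x\<in>A. inv_into (C x) (g x) (\<tau> (f x))) ` Pi\<^sub>E A' C' \<subseteq> Pi\<^sub>E A C"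
    using fA gC' by (auto simp: PiE_iff)
qed

section \<open>Translation of choice sequences and histories\<close>

definition trace :: "('m list \<Rightarrow> 'm \<Rightarrow> 'n) \<Rightarrow> 'm list \<Rightarrow> 'n list" where
  "trace \<theta> cs = map (\<lambda>t. \<theta> (take t cs) (cs ! t)) [0..<length cs]"

lemma trace_Nil [simp]: "trace \<theta> [] = []"
  and trace_snoc [simp]: "trace \<theta> (cs @ [m]) = trace \<theta> cs @ [\<theta> cs m]"
  and length_trace [simp]: "length (trace \<theta> cs) = length cs"
  by (auto simp: trace_def nth_append)

text \<open>Bids are copied and only choices are translated, each in the context of the choices
  before it. Hence winners and budgets agree on both sides.\<close>

definition lift_history :: "('m list \<Rightarrow> 'm \<Rightarrow> 'n) \<Rightarrow> 'm history \<Rightarrow> 'n history" where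
  "lift_history \<theta> h = zip (map fst h) (trace \<theta> (map snd h))"

lemma lift_history_Nil [simp]: "lift_history \<theta> [] = []"
  and lift_history_snoc [simp]:
    "lift_history \<theta> (h @ [(b, m)]) = lift_history \<theta> h @ [(b, \<theta> (map snd h) m)]"
  by (simp_all add: lift_history_def)

lemma length_lift_history [simp]: "length (lift_history \<theta> h) = length h"
  by (simp add: lift_history_def)

lemma map_snd_lift_history [simp]: "map snd (lift_history \<theta> h) = trace \<theta> (map snd h)"
  by (simp add: lift_history_def)

lemma budget_after_lift_history [simp]: "budget_after B (lift_history \<theta> h) = budget_after B h"
  by (induction h rule: rev_induct) (auto simp: budget_after_def)

text \<open>Two processes with the same tree of play up to renaming: \<open>\<theta> cs\<close>
  renames the options at position \<open>cs\<close>. The bound \<open>N\<close> makes play end, and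
  payoffs are compared only where it has ended.\<close>

locale process_isomorphism =
  fixes P :: "'m process" and Q :: "'n process" and \<theta> :: "'m list \<Rightarrow> 'm \<Rightarrow> 'n" and N :: nat
  assumes choices_bij: "feasible P cs \<Longrightarrow> bij_betw (\<theta> cs) (choices P cs) (choices Q (trace \<theta> cs))"
    and horizon: "feasible P cs \<Longrightarrow> length cs \<le> N"
    and payoff_eq: "feasible P cs \<Longrightarrow> choices P cs = {} \<Longrightarrow> payoff Q i (trace \<theta> cs) = payoff P i cs"
begin

abbreviation "lift \<equiv> lift_history \<theta>"

lemma available_bij:
  "h \<in> histories P \<epsilon> B \<Longrightarrow> bij_betw (\<theta> (map snd h)) (available P h) (available Q (lift h))"
  using choices_bij[OF histories_feasible] by (simp add: available_def)

lemma available_lift_empty: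
  "h \<in> histories P \<epsilon> B \<Longrightarrow> available Q (lift h) = {} \<longleftrightarrow> available P h = {}"
  using available_bij by (fastforce simp: bij_betw_def)

lemma lift_histories: "h \<in> histories P \<epsilon> B \<Longrightarrow> lift h \<in> histories Q \<epsilon> B"
proof (induction rule: histories.induct)
  case (extend h b m)
  then show ?case
    using available_bij[of h \<epsilon> B] by (auto simp: bij_betw_def intro!: histories.extend)
qed (simp add: histories.start)

text \<open>The renaming of the last choice depends on the earlier choices, so the induction
  identifies these first; then a single injective renaming is left.\<close>

lemma lift_inj: "h \<in> histories P \<epsilon> B \<Longrightarrow> h' \<in> histories P \<epsilon> B \<Longrightarrow> lift h = lift h' \<Longrightarrow> h = h'"
proof (induction arbitrary: h' rule: histories.induct)
  case start
  then show ?case by (metis length_0_conv length_lift_history)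
next
  case (extend h b m)
  from extend.prems(1) show ?case
  proof cases
    case start
    with extend.prems(2) show ?thesis by simp
  next
    case (extend h'' b' m')
    with extend.prems extend.IH[of h''] have "h = h''" "b = b'"
      and "\<theta> (map snd h) m = \<theta> (map snd h'') m'" by auto
    with extend(4) \<open>m \<in> available P h\<close> available_bij[OF \<open>h \<in> histories P \<epsilon> B\<close>] have "m = m'"
      by (auto simp: bij_betw_def inj_on_def)
    with extend \<open>h = h''\<close> \<open>b = b'\<close> show ?thesis by simp
  qed
qed

lemma lift_surj: "h' \<in> histories Q \<epsilon> B \<Longrightarrow> \<exists>h\<in>histories P \<epsilon> B. lift h = h'"
proof (induction rule: histories.induct)
  case start
  then show ?case by (auto intro!: bexI[of _ "[]"] histories.start)
next
  case (extend h' b m')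
  then obtain h where h: "h \<in> histories P \<epsilon> B" "lift h = h'" by blast
  moreover have "m' \<in> \<theta> (map snd h) ` available P h"
    using extend.hyps available_bij[OF h(1)] h(2) by (simp add: bij_betw_def)
  then obtain m where "m \<in> available P h" "\<theta> (map snd h) m = m'" by blast
  ultimately show ?case using extend.hyps
    by (intro bexI[of _ "h @ [(b, m)]"]) (auto intro!: histories.extend)
qed

lemma decision_points_bij: "bij_betw lift (decision_points P \<epsilon> B) (decision_points Q \<epsilon> B)"
  unfolding bij_betw_def
proof
  show "inj_on lift (decision_points P \<epsilon> B)"
    by (auto simp: inj_on_def decision_points_def intro: lift_inj)
  have "h' \<in> lift ` decision_points P \<epsilon> B" if h': "h' \<in> decision_points Q \<epsilon> B" for h'
  proof -
    from h' obtain h where "h \<in> histories P \<epsilon> B" "lift h = h'"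
      using lift_surj[of h' \<epsilon> B] by (auto simp: decision_points_def)
    with h' available_lift_empty[of h \<epsilon> B] show ?thesis by (auto simp: decision_points_def)
  qed
  then show "lift ` decision_points P \<epsilon> B = decision_points Q \<epsilon> B"
    by (auto simp: decision_points_def lift_histories available_lift_empty)
qed

text \<open>A decision point of \<open>Q\<close> is pulled back to its unique preimage in
  \<open>P\<close>, and only the submitted choice is renamed. The map acts on one player's strategy
  without reference to the opponent, as \<open>equivalent\<close> demands.\<close>

definition map_strategy :: "real \<Rightarrow> (player \<Rightarrow> real) \<Rightarrow> 'm strategy \<Rightarrow> 'n strategy" where
  "map_strategy \<epsilon> B \<sigma> = (\<lambda>h'\<in>decision_points Q \<epsilon> B.
     let h = inv_into (decision_points P \<epsilon> B) lift h' in map_prod id (\<theta> (map snd h)) (\<sigma> h))"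

lemma strategies_bij: "bij_betw (map_strategy \<epsilon> B) (strategies P \<epsilon> B i) (strategies Q \<epsilon> B i)"
  unfolding strategies_def map_strategy_def Let_def
proof (rule bij_betw_PiE[OF decision_points_bij])
  fix h assume "h \<in> decision_points P \<epsilon> B"
  then have "bij_betw (\<theta> (map snd h)) (available P h) (available Q (lift h))"
    by (auto simp: decision_points_def intro: available_bij)
  then show "bij_betw (map_prod id (\<theta> (map snd h))) (bids \<epsilon> (budget_after B h i) \<times> available P h)
      (bids \<epsilon> (budget_after B (lift h) i) \<times> available Q (lift h))"
    by (auto intro: bij_betw_map_prod)
qed

lemma map_strategy_lift:
  "h \<in> decision_points P \<epsilon> B \<Longrightarrow> map_strategy \<epsilon> B \<sigma> (lift h) = map_prod id (\<theta> (map snd h)) (\<sigma> h)"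
  using decision_points_bij[of \<epsilon> B] by (auto simp: map_strategy_def bij_betw_def Let_def)

text \<open>The bids are the same on both sides, so the same player wins and the implemented choice
  is the renamed one.\<close>

lemma next_round_lift:
  assumes "h \<in> decision_points P \<epsilon> B"
  shows "lift (h @ [next_round \<sigma> h])
    = lift h @ [next_round (\<lambda>j. map_strategy \<epsilon> B (\<sigma> j)) (lift h)]"
  using map_strategy_lift[OF assms] by (simp add: next_round_def Let_def)

text \<open>\<open>play\<close> keeps running after the game has ended, where strategies take
  unspecified values; hence the hypothesis that all earlier positions still offer a choice.\<close>

lemma play_histories:
  assumes "\<sigma> \<in> profiles P \<epsilon> B" and "\<forall>m<n. available P (play P \<sigma> m) \<noteq> {}"
  shows "play P \<sigma> n \<in> histories P \<epsilon> B
    \<and> play Q (\<lambda>j. map_strategy \<epsilon> B (\<sigma> j)) n = lift (play P \<sigma> n)"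
  using assms(2)
proof (induction n)
  case 0
  then show ?case by (simp add: histories.start)
next
  case (Suc n)
  then have h: "play P \<sigma> n \<in> decision_points P \<epsilon> B"
    and eq: "play Q (\<lambda>j. map_strategy \<epsilon> B (\<sigma> j)) n = lift (play P \<sigma> n)"
    by (auto simp: decision_points_def)
  have "\<sigma> i (play P \<sigma> n) \<in> bids \<epsilon> (budget_after B (play P \<sigma> n) i) \<times> available P (play P \<sigma> n)" for i
    using assms(1) h by (auto simp: profiles_def strategies_def PiE_mem)
  then have "play P \<sigma> (Suc n) \<in> histories P \<epsilon> B"
    using h by (auto simp: next_round_def Let_def decision_points_def mem_Times_iff
        intro!: histories.extend)
  then show ?case using next_round_lift[OF h] by (simp add: eq)
qed

lemma play_terminates:
  assumes "\<sigma> \<in> profiles P \<epsilon> B"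
  shows "\<exists>n. available P (play P \<sigma> n) = {}"
proof (rule ccontr)
  assume "\<not> ?thesis"
  \<comment> \<open>A play that never stops would contain a feasible sequence of length
    \<open>N + 1\<close>.\<close>
  then have "feasible P (map snd (play P \<sigma> (Suc N)))"
    using play_histories[OF assms, of "Suc N"] histories_feasible by blast
  moreover have "length (play P \<sigma> n) = n" for n by (induction n) auto
  ultimately show False using horizon by fastforce
qed

lemma utility_map_strategy:
  assumes \<sigma>: "\<sigma> \<in> profiles P \<epsilon> B"
  shows "utility Q (\<lambda>j. map_strategy \<epsilon> B (\<sigma> j)) i = utility P \<sigma> i"
proof -
  define n where "n = (LEAST n. available P (play P \<sigma> n) = {})"
  let ?\<tau> = "\<lambda>j. map_strategy \<epsilon> B (\<sigma> j)"
  have stop: "available P (play P \<sigma> n) = {}"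
    unfolding n_def by (rule LeastI_ex) (rule play_terminates[OF \<sigma>])
  have before: "available P (play P \<sigma> m) \<noteq> {}" if "m < n" for m
    using that not_less_Least unfolding n_def by blast
  have hist: "play P \<sigma> m \<in> histories P \<epsilon> B" "play Q ?\<tau> m = lift (play P \<sigma> m)" if "m \<le> n" for m
    using play_histories[OF \<sigma>, of m] before that by auto
  \<comment> \<open>Up to round \<open>n\<close> the two plays correspond, so they run out of
    choices in the same round.\<close>
  have "(LEAST n. available Q (play Q ?\<tau> n) = {}) = n"
    using stop before hist available_lift_empty
    by (intro Least_equality) (metis order_refl, metis leI less_imp_le)
  then have "outcome Q ?\<tau> = lift (outcome P \<sigma>)"
    using hist(2)[OF order_refl] by (simp add: outcome_def n_def)
  moreover have "outcome P \<sigma> = play P \<sigma> n" by (simp add: outcome_def n_def)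
  ultimately show ?thesis
    using payoff_eq[OF histories_feasible[OF hist(1)[OF order_refl]]] stop
    by (simp add: utility_def available_def)
qed

lemma equivalent: "equivalent P Q"
  unfolding equivalent_def
  using strategies_bij utility_map_strategy by (meson exI)

end

text \<open>A game structure may merge positions of the process: different choice sequences may lead to
  the same state, but different choices at the same position may not.\<close>

lemma equivalent_bidding_game:
  fixes st :: "'m list \<Rightarrow> 's"
  assumes init: "st [] = init G"
    and moves: "\<And>cs. feasible P cs \<Longrightarrow> choices P cs \<noteq> {} \<Longrightarrow>
      st cs \<notin> terminals G \<and> bij_betw (\<lambda>m. st (cs @ [m])) (choices P cs) (moves G (st cs))"
    and final: "\<And>cs i. feasible P cs \<Longrightarrow> choices P cs = {} \<Longrightarrow>
      st cs \<in> terminals G \<and> util G i (st cs) = payoff P i cs"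
    and horizon: "\<And>cs. feasible P cs \<Longrightarrow> length cs \<le> N"
  shows "equivalent P (bidding_game G)"
proof -
  \<comment> \<open>A choice is renamed to the state it leads to, so
    \<open>trace \<theta> cs\<close> is the path of states visited after the initial one.\<close>
  define \<theta> where "\<theta> = (\<lambda>cs m. st (cs @ [m]))"
  have last: "last (init G # trace \<theta> cs) = st cs" for cs
    by (cases cs rule: rev_cases) (auto simp: \<theta>_def init)
  have game: "choices (bidding_game G) (trace \<theta> cs)
      = (if st cs \<in> terminals G then {} else moves G (st cs))"
    "payoff (bidding_game G) i (trace \<theta> cs) = util G i (st cs)" for cs i
    using last[of cs] by (simp_all add: bidding_game_def del: last.simps)
  interpret process_isomorphism P "bidding_game G" \<theta> N
  proof
    fix cs assume "feasible P cs"
    then show "bij_betw (\<theta> cs) (choices P cs) (choices (bidding_game G) (trace \<theta> cs))"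
      using moves[of cs] final[of cs]
      by (cases "choices P cs = {}") (simp_all add: game, simp_all add: \<theta>_def bij_betw_def)
  qed (use horizon final in \<open>simp_all add: game\<close>)
  show ?thesis by (rule equivalent)
qed

section \<open>Running time and correctness of programs\<close>

text \<open>Total correctness, with the step count exposed to the postcondition. Execution is
  deterministic, so the run asserted to exist is the only one.\<close>

definition wp :: "(player \<Rightarrow> nat list \<Rightarrow> real) \<Rightarrow> com \<Rightarrow> store \<Rightarrow> (nat \<Rightarrow> store \<Rightarrow> bool) \<Rightarrow> bool" where
  "wp f c s Q \<longleftrightarrow> (\<exists>n s'. exec f c s n s' \<and> Q n s')"

lemma wp_exec: "exec f c s n s' \<Longrightarrow> wp f c s Q \<longleftrightarrow> Q n s'"
  unfolding wp_def using exec_deterministic by blast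

lemma wp_Assign [simp]: "wp f (Assign x e) s Q
    \<longleftrightarrow> Q (1 + cost e) (s\<lparr>reg := (reg s)(x := ev e s)\<rparr>)"
  by (rule wp_exec[OF exec.Assign])

lemma wp_Put [simp]: "wp f (Put a e e') s Q
    \<longleftrightarrow> Q (1 + cost e + cost e') (s\<lparr>arr := (arr s)(a := (arr s a)(ev e s := ev e' s))\<rparr>)"
  by (rule wp_exec[OF exec.Put])

lemma wp_Query [simp]: "wp f (Query i e a e') s Q
    \<longleftrightarrow> Q (1 + cost e + cost e' + ev e' s)
      (s\<lparr>tab := (tab s)(i := (tab s i)(ev e s := f i (map (arr s a) [0..<ev e' s])))\<rparr>)"
  by (rule wp_exec[OF exec.Query])

lemma wp_Seq [simp]:
  "wp f (Seq c c') s Q \<longleftrightarrow> wp f c s (\<lambda>n s'. wp f c' s' (\<lambda>n'. Q (n + n')))"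
proof
  assume "wp f (Seq c c') s Q"
  then show "wp f c s (\<lambda>n s'. wp f c' s' (\<lambda>n'. Q (n + n')))"
    unfolding wp_def by (blast elim: SeqE)
next
  assume "wp f c s (\<lambda>n s'. wp f c' s' (\<lambda>n'. Q (n + n')))"
  then show "wp f (Seq c c') s Q"
    unfolding wp_def by (metis exec.Seq)
qed

lemma wp_IfLess [simp]:
  "wp f (IfLess e e' c c') s Q \<longleftrightarrow>
    (if ev e s < ev e' s then wp f c s (\<lambda>n. Q (1 + cost e + cost e' + n))
     else wp f c' s (\<lambda>n. Q (1 + cost e + cost e' + n)))"
proof (cases "ev e s < ev e' s")
  case True
  have "exec f (IfLess e e' c c') s n s'
      \<longleftrightarrow> (\<exists>m. n = 1 + cost e + cost e' + m \<and> exec f c s m s')" for n s'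
  proof
    assume "exec f (IfLess e e' c c') s n s'"
    then show "\<exists>m. n = 1 + cost e + cost e' + m \<and> exec f c s m s'"
      by (rule IfE) (use True in auto)
  next
    assume "\<exists>m. n = 1 + cost e + cost e' + m \<and> exec f c s m s'"
    then obtain m where "n = 1 + cost e + cost e' + m" "exec f c s m s'" by blast
    then show "exec f (IfLess e e' c c') s n s'"
      using exec.IfTrue[OF True] by simp
  qed
  with True show ?thesis unfolding wp_def by auto
next
  case False
  have "exec f (IfLess e e' c c') s n s'
      \<longleftrightarrow> (\<exists>m. n = 1 + cost e + cost e' + m \<and> exec f c' s m s')" for n s'
  proof
    assume "exec f (IfLess e e' c c') s n s'"
    then show "\<exists>m. n = 1 + cost e + cost e' + m \<and> exec f c' s m s'"
      by (rule IfE) (use False in auto)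
  next
    assume "\<exists>m. n = 1 + cost e + cost e' + m \<and> exec f c' s m s'"
    then obtain m where "n = 1 + cost e + cost e' + m" "exec f c' s m s'" by blast
    then show "exec f (IfLess e e' c c') s n s'"
      using exec.IfFalse[OF False] by simp
  qed
  with False show ?thesis unfolding wp_def by auto
qed

text \<open>Keeps the simplifier from executing the continuation before the state it starts from is known.\<close>

lemma wp_cong [cong]: "s = s' \<Longrightarrow> wp f c s Q = wp f c s' Q"
  by simp

lemma wp_mono: "wp f c s Q \<Longrightarrow> (\<And>n s'. Q n s' \<Longrightarrow> Q' n s') \<Longrightarrow> wp f c s Q'"
  unfolding wp_def by blast

text \<open>For loops whose number of passes \<open>m\<close> is known beforehand: the invariant is
  indexed by the passes done and so also yields termination. The guard is evaluated
  \<open>m + 1\<close> times, the body \<open>m\<close> times.\<close>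

lemma wp_WhileLess:
  assumes "I 0 s"
    and step: "\<And>i s. i < m \<Longrightarrow> I i s \<Longrightarrow>
      ev e s < ev e' s \<and> wp f c s (\<lambda>n s'. n \<le> N \<and> I (Suc i) s')"
    and stop: "\<And>s. I m s \<Longrightarrow> \<not> ev e s < ev e' s"
  shows "wp f (WhileLess e e' c) s
    (\<lambda>n s'. n \<le> (m + 1) * (1 + cost e + cost e') + m * N \<and> I m s')"
proof -
  let ?C = "1 + cost e + cost e'"
  \<comment> \<open>Downward induction on \<open>i\<close> from \<open>m\<close>, with the time for
    the remaining \<open>m - i\<close> passes.\<close>
  have "wp f (WhileLess e e' c) s (\<lambda>n s'. n \<le> (m - i + 1) * ?C + (m - i) * N \<and> I m s')"
    if "I i s" "i \<le> m" for i s
    using that(2,1)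
  proof (induction i arbitrary: s rule: inc_induct)
    case base
    then show ?case
      using exec.WhileFalse[OF stop] unfolding wp_def by fastforce
  next
    case (step i)
    from assms(2)[OF \<open>i < m\<close> \<open>I i s\<close>] obtain n s'
      where g: "ev e s < ev e' s" and s': "exec f c s n s'" "n \<le> N" "I (Suc i) s'"
      unfolding wp_def by blast
    from step.IH[OF s'(3)] obtain n' s'' where "exec f (WhileLess e e' c) s' n' s''"
      and n': "n' \<le> (m - Suc i + 1) * ?C + (m - Suc i) * N" and "I m s''"
      unfolding wp_def by blast
    with exec.WhileTrue[OF g s'(1)] have "exec f (WhileLess e e' c) s (?C + n + n') s''"
      by simp
    moreover have "m - i = Suc (m - Suc i)" using \<open>i < m\<close> by simp
    then have "?C + n + n' \<le> (m - i + 1) * ?C + (m - i) * N"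
      using n' s'(2) by simp
    ultimately show ?case using \<open>I m s''\<close> unfolding wp_def by blast
  qed
  from this[OF assms(1)] show ?thesis unfolding minus_nat.diff_0 by simp
qed

section \<open>Blocks, frame conditions and variable names\<close>

fun block :: "com list \<Rightarrow> com" where
  "block [] = Assign [] (Num 0)"
| "block [c] = c"
| "block (c # c' # cs) = Seq c (block (c' # cs))"

lemma wp_block [simp]: "wp f (block (c # c' # cs)) s Q
    \<longleftrightarrow> wp f c s (\<lambda>n s'. wp f (block (c' # cs)) s' (\<lambda>n'. Q (n + n')))"
    "wp f (block [c]) s Q \<longleftrightarrow> wp f c s Q"
  by (simp_all cong del: wp_cong)

text \<open>Frame condition: \<open>R\<close> and \<open>A\<close> collect the registers and arrays
  that a program may overwrite. The table \<open>tab\<close> is tracked separately where it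
  matters.\<close>

definition agree :: "name set \<Rightarrow> name set \<Rightarrow> store \<Rightarrow> store \<Rightarrow> bool" where
  "agree R A s s' \<longleftrightarrow> (\<forall>x. x \<notin> R \<longrightarrow> reg s' x = reg s x) \<and> (\<forall>a. a \<notin> A \<longrightarrow> arr s' a = arr s a)"

text \<open>Opaque constants spare the simplifier comparisons of strings; the literals matter again
  only at the input and output formats.\<close>

definition kR :: name where "kR = ''k''"
definition qR :: name where "qR = ''q''"
definition MR :: name where "MR = ''M''"
definition NR :: name where "NR = ''N''"
definition rR :: name where "rR = ''r''"
definition jR :: name where "jR = ''j''"
definition xR :: name where "xR = ''x''"
definition iR :: name where "iR = ''i''"
definition bR :: name where "bR = ''b''"
definition cR :: name where "cR = ''c''"
definition DR :: name where "DR = ''D''"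
definition yR :: name where "yR = ''y''"
definition zR :: name where "zR = ''z''"
definition nR :: name where "nR = ''n''"
definition initR :: name where "initR = ''init''"
definition wA :: name where "wA = ''w''"
definition orderA :: name where "orderA = ''order''"
definition codeA :: name where "codeA = ''code''"
definition pA :: name where "pA = ''p''"
definition vA :: name where "vA = ''v''"
definition succA :: name where "succA = ''succ''"
definition offA :: name where "offA = ''off''"
definition degA :: name where "degA = ''deg''"

lemmas name_defs = kR_def qR_def MR_def NR_def rR_def jR_def xR_def iR_def bR_def cR_def DR_def
  yR_def zR_def nR_def initR_def wA_def orderA_def codeA_def pA_def vA_def succA_def offA_def
  degA_def

text \<open>Each list is given forwards and backwards so that every inequation is a rewrite rule in
  both directions.\<close>

lemma distinct_names [simplified, simp]:
  "distinct [kR, qR, MR, NR, rR, jR, xR, iR, bR, cR, DR, yR, zR, nR, initR]"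
  "distinct [initR, nR, zR, yR, DR, cR, bR, iR, xR, jR, rR, NR, MR, qR, kR]"
  "distinct [wA, orderA, codeA, pA, vA, succA, offA, degA]"
  "distinct [degA, offA, succA, vA, pA, codeA, orderA, wA]"
  by (simp_all add: name_defs)

section \<open>Mixed-radix notation\<close>

text \<open>The value of position \<open>r\<close> in the mixed radix whose digit \<open>i\<close>
  runs from \<open>0\<close> to \<open>W i\<close>.\<close>

definition place :: "(nat \<Rightarrow> nat) \<Rightarrow> nat \<Rightarrow> nat" where
  "place W r = (\<Prod>i<r. W i + 1)"

lemma place_0 [simp]: "place W 0 = 1"
  and place_Suc: "place W (Suc r) = place W r * (W r + 1)"
  by (simp_all add: place_def)

lemma place_pos [simp]: "0 < place W r"
  by (simp add: place_def)

lemma place_dvd: "r \<le> r' \<Longrightarrow> place W r dvd place W r'"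
  unfolding place_def by (intro prod_dvd_prod_subset) auto

text \<open>The sum telescopes, since \<open>W i * place W i = place W (Suc i) - place W i\<close>.
  So the numeral with all digits maximal is \<open>place W n - 1\<close>.\<close>

lemma sum_place: "(\<Sum>i<n. W i * place W i) + 1 = place W n"
  by (induction n) (auto simp: place_Suc algebra_simps)

text \<open>\<open>W r + 1\<close> divides \<open>place W (Suc r)\<close> and hence the positive
  number \<open>place W n\<close>.\<close>

lemma less_place: "r < n \<Longrightarrow> W r + 1 \<le> place W n"
  using place_dvd[of "Suc r" n W] place_Suc[of W r] place_pos[of W n] place_pos[of W r]
  by (metis Suc_leI dvd_imp_le dvd_mult_left dvd_trans dvd_triv_right)

lemma digits_less_place:
  assumes "\<And>i. i < n \<Longrightarrow> v i \<le> W i"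
  shows "(\<Sum>i<n. v i * place W i) < place W n"
proof -
  have "(\<Sum>i<n. v i * place W i) \<le> (\<Sum>i<n. W i * place W i)"
    using assms by (intro sum_mono) auto
  then show ?thesis using sum_place[of W n] by linarith
qed

definition digit :: "(nat \<Rightarrow> nat) \<Rightarrow> nat \<Rightarrow> nat \<Rightarrow> nat" where
  "digit W c r = c mod place W (Suc r) div place W r"

text \<open>Higher positions are multiples of \<open>place W (Suc r)\<close> and vanish under
  \<open>mod\<close>; lower positions sum to less than \<open>place W r\<close> and vanish under
  \<open>div\<close>.\<close>

lemma digit_sum:
  assumes "\<And>i. i < n \<Longrightarrow> v i \<le> W i" and "r < n"
  shows "digit W (\<Sum>i<n. v i * place W i) r = v r"
proof -
  have "(\<Sum>i<n. v i * place W i)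
      = (\<Sum>i<Suc r. v i * place W i) + (\<Sum>i=Suc r..<n. v i * place W i)"
    using assms(2) sum.atLeastLessThan_concat[of 0 "Suc r" n "\<lambda>i. v i * place W i"]
    by (simp add: atLeast0LessThan del: sum.lessThan_Suc)
  moreover have "place W (Suc r) dvd (\<Sum>i=Suc r..<n. v i * place W i)"
    by (intro dvd_sum dvd_mult place_dvd) simp
  moreover have "(\<Sum>i<Suc r. v i * place W i) < place W (Suc r)"
    using assms by (intro digits_less_place) auto
  ultimately have "(\<Sum>i<n. v i * place W i) mod place W (Suc r) = (\<Sum>i<Suc r. v i * place W i)"
    by (auto elim!: dvdE simp del: sum.lessThan_Suc)
  moreover have "(\<Sum>i<r. v i * place W i) < place W r"
    using assms by (intro digits_less_place) auto
  ultimately show ?thesis by (simp add: digit_def)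
qed

text \<open>The bargaining as the program sees it: items are numbers below \<open>k\<close>, and
  \<open>ord t\<close> is the item offered in round \<open>t\<close>.\<close>

locale ram_input =
  fixes f :: "player \<Rightarrow> nat list \<Rightarrow> real" and k q :: nat and wt :: "nat \<Rightarrow> nat \<Rightarrow> nat"
    and ord :: "nat \<Rightarrow> nat"
  assumes ord_bij: "bij_betw ord {..<k} {..<k}"
begin

lemma ord: "t < k \<Longrightarrow> ord t < k"
  using bij_betwE[OF ord_bij] by simp

definition wsum :: "nat \<Rightarrow> nat" where "wsum r = (\<Sum>j<k. wt j r)"
definition M :: nat where "M = place wsum q"
definition code :: "nat \<Rightarrow> nat" where "code j = (\<Sum>r<q. wt j r * place wsum r)"

lemma M_pos [simp]: "0 < M"
  by (simp add: M_def)

text \<open>Bounds the number of additions by which a weight is multiplied with a place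
  value.\<close>

lemma wt_less_M:
  assumes "j < k" "r < q"
  shows "wt j r + 1 \<le> M"
proof -
  have "wt j r \<le> wsum r"
    unfolding wsum_def using assms by (intro member_le_sum) auto
  then show ?thesis
    using less_place[OF \<open>r < q\<close>, of wsum] by (simp add: M_def)
qed

end

section \<open>The construction as a program\<close>

text \<open>In the absence of multiplication, weight times place value is formed by repeated
  addition. \<open>NR\<close> receives the same summands as the codes, so over a whole column it
  grows from \<open>MR\<close> to the next place value.\<close>

definition encode_weight :: com where
  "encode_weight = WhileLess (Reg iR) (Get wA (Reg xR)) (block
    [Put codeA (Reg jR) (Add (Get codeA (Reg jR)) (Reg MR)),
     Assign NR (Add (Reg NR) (Reg MR)),
     Assign iR (Add (Reg iR) (Num 1))])"

text \<open>\<open>xR\<close> walks down a column of the matrix stored row by row, in steps of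
  \<open>q\<close>.\<close>

definition encode_column :: com where
  "encode_column = WhileLess (Reg jR) (Reg kR) (block
    [Assign iR (Num 0), encode_weight,
     Assign xR (Add (Reg xR) (Reg qR)),
     Assign jR (Add (Reg jR) (Num 1))])"

definition encode_items :: com where
  "encode_items = block [Assign MR (Num 1), Assign rR (Num 0),
    WhileLess (Reg rR) (Reg qR) (block
      [Put pA (Reg rR) (Reg MR), Assign NR (Reg MR), Assign jR (Num 0),
       Assign xR (Reg rR), encode_column, Assign MR (Reg NR),
       Assign rR (Add (Reg rR) (Num 1))])]"

lemma wp_encode_weight:
  assumes "reg s iR = 0"
  shows "wp f encode_weight s (\<lambda>n s'. n \<le> 18 * (arr s wA (reg s xR) + 1)
    \<and> agree {iR, NR} {codeA} s s'
    \<and> reg s' NR = reg s NR + arr s wA (reg s xR) * reg s MR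
    \<and> (\<forall>j. arr s' codeA j = arr s codeA j
        + (if j = reg s jR then arr s wA (reg s xR) * reg s MR else 0)))"
proof -
  let ?I = "\<lambda>i s'. agree {iR, NR} {codeA} s s' \<and> reg s' iR = i
    \<and> reg s' NR = reg s NR + i * reg s MR
    \<and> (\<forall>j. arr s' codeA j
        = arr s codeA j + (if j = reg s jR then i * reg s MR else 0))"
  let ?m = "arr s wA (reg s xR)"
  \<comment> \<open>One pass of the body costs 6 + 4 + 4 = 14 steps.\<close>
  have "wp f encode_weight s (\<lambda>n s'. n \<le> (?m + 1) * (1 + cost (Reg iR) + cost (Get wA (Reg xR)))
    + ?m * 14 \<and> ?I ?m s')"
    unfolding encode_weight_def
    by (rule wp_WhileLess[where I = ?I]) (use assms in \<open>simp_all add: agree_def add_ac\<close>)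
  then show ?thesis by (rule wp_mono) auto
qed

context ram_input
begin

lemma wp_encode_column:
  assumes "reg s kR = k" "reg s qR = q" "r < q" "reg s jR = 0" "reg s xR = r"
    and w: "\<And>j r. j < k \<Longrightarrow> r < q \<Longrightarrow> arr s wA (j * q + r) = wt j r"
  shows "wp f encode_column s (\<lambda>n s'. n \<le> 31 * ((k + 1) * M)
    \<and> agree {iR, NR, xR, jR} {codeA} s s'
    \<and> reg s' NR = reg s NR + wsum r * reg s MR
    \<and> (\<forall>j<k. arr s' codeA j = arr s codeA j + wt j r * reg s MR))"
proof -
  let ?I = "\<lambda>j s'. agree {iR, NR, xR, jR} {codeA} s s' \<and> reg s' jR = j
    \<and> reg s' xR = j * q + r
    \<and> reg s' NR = reg s NR + (\<Sum>j'<j. wt j' r) * reg s MR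
    \<and> (\<forall>j'. arr s' codeA j'
        = arr s codeA j' + (if j' < j then wt j' r * reg s MR else 0))"
  have loop: "wp f encode_column s
    (\<lambda>n s'. n \<le> (k + 1) * (1 + cost (Reg jR) + cost (Reg kR)) + k * (10 + 18 * M) \<and> ?I k s')"
    unfolding encode_column_def
  proof (rule wp_WhileLess[where I = ?I])
    fix j s' assume j: "j < k" and I: "?I j s'"
    have w': "arr s' wA (reg s' xR) = wt j r"
      using I w[OF j \<open>r < q\<close>] by (simp add: agree_def)
    have "18 * (wt j r + 1) \<le> 18 * M"
      using wt_less_M[OF j \<open>r < q\<close>] by simp
    with I j w' assms(1,2) show "ev (Reg jR) s' < ev (Reg kR) s' \<and>
      wp f (block [Assign iR (Num 0), encode_weight,
        Assign xR (Add (Reg xR) (Reg qR)), Assign jR (Add (Reg jR) (Num 1))]) s'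
        (\<lambda>n s'. n \<le> 10 + 18 * M \<and> ?I (Suc j) s')"
      by (auto simp: agree_def algebra_simps intro!: wp_mono[OF wp_encode_weight])
  qed (use assms in \<open>auto simp: agree_def\<close>)
  \<comment> \<open>As \<open>1 \<le> M\<close>, constants are absorbed into multiples of
    \<open>M\<close>; \<open>31\<close> is \<open>3 + 10 + 18\<close>.\<close>
  have "(k + 1) * (1 + cost (Reg jR) + cost (Reg kR)) + k * (10 + 18 * M)
      \<le> 31 * ((k + 1) * M)"
    using M_pos by (cases M) (auto simp: algebra_simps)
  then show ?thesis
    by (intro wp_mono[OF loop]) (auto simp: wsum_def)
qed

lemma wp_encode_items:
  assumes "reg s kR = k" "reg s qR = q" "\<And>j. arr s codeA j = 0"
    and w: "\<And>j r. j < k \<Longrightarrow> r < q \<Longrightarrow> arr s wA (j * q + r) = wt j r"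
  shows "wp f encode_items s (\<lambda>n s'. n \<le> 60 * ((q + 1) * ((k + 1) * M))
    \<and> agree {iR, NR, xR, jR, MR, rR} {codeA, pA} s s'
    \<and> reg s' MR = M \<and> (\<forall>r<q. arr s' pA r = place wsum r)
    \<and> (\<forall>j<k. arr s' codeA j = code j))"
proof -
  let ?I = "\<lambda>r s'. agree {iR, NR, xR, jR, MR, rR} {codeA, pA} s s'
    \<and> reg s' rR = r \<and> reg s' MR = place wsum r
    \<and> (\<forall>r'<r. arr s' pA r' = place wsum r')
    \<and> (\<forall>j<k. arr s' codeA j = (\<Sum>r'<r. wt j r' * place wsum r'))"
  let ?s = "s\<lparr>reg := (reg s)(MR := Suc 0, rR := 0)\<rparr>"
  let ?body = "block
      [Put pA (Reg rR) (Reg MR), Assign NR (Reg MR), Assign jR (Num 0),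
       Assign xR (Reg rR), encode_column, Assign MR (Reg NR),
       Assign rR (Add (Reg rR) (Num 1))]"
  have loop: "wp f (WhileLess (Reg rR) (Reg qR) ?body) ?s
    (\<lambda>n s'. n \<le> (q + 1) * (1 + cost (Reg rR) + cost (Reg qR))
      + q * (15 + 31 * ((k + 1) * M)) \<and> ?I q s')"
  proof (rule wp_WhileLess[where I = ?I])
    fix r s' assume r: "r < q" and I: "?I r s'"
    with assms show "ev (Reg rR) s' < ev (Reg qR) s' \<and>
        wp f ?body s' (\<lambda>n s'. n \<le> 15 + 31 * ((k + 1) * M) \<and> ?I (Suc r) s')"
      by (auto simp: agree_def algebra_simps place_Suc less_Suc_eq
          intro!: wp_mono[OF wp_encode_column[of _ r]])
  qed (use assms in \<open>auto simp: agree_def\<close>)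
  have "4 + ((q + 1) * (1 + cost (Reg rR) + cost (Reg qR))
      + q * (15 + 31 * ((k + 1) * M))) \<le> 60 * ((q + 1) * ((k + 1) * M))"
    using M_pos by (cases M) (auto simp: algebra_simps)
  then show ?thesis unfolding encode_items_def
    by (simp, intro wp_mono[OF loop], simp add: M_def code_def)
qed

end

text \<open>
  State \<open>h * 2M + b * M + c\<close> has \<open>h\<close> items left; \<open>b = 1\<close> iff player 2 received the
  last one, and \<open>c\<close> is the code of player 1's items. The layer \<open>h = 0\<close> is terminal. States in
  which player 1's code would overflow are unreachable; there the code is left unchanged.
\<close>

definition build_layer :: com where
  "build_layer = WhileLess (Reg yR) (Reg DR) (block
    [IfLess (Reg yR) (Reg MR) (Assign zR (Reg yR)) (Assign zR (Sub (Reg yR) (Reg MR))),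
     Put degA (Reg xR) (Num 2),
     Put offA (Reg xR) (Add (Reg xR) (Reg xR)),
     IfLess (Add (Reg zR) (Reg cR)) (Reg MR)
       (Put succA (Add (Reg xR) (Reg xR)) (Add (Reg bR) (Add (Reg zR) (Reg cR))))
       (Put succA (Add (Reg xR) (Reg xR)) (Add (Reg bR) (Reg zR))),
     Put succA (Add (Add (Reg xR) (Reg xR)) (Num 1)) (Add (Add (Reg bR) (Reg MR)) (Reg zR)),
     Assign xR (Add (Reg xR) (Num 1)),
     Assign yR (Add (Reg yR) (Num 1))])"

text \<open>Layers are filled from the bottom up, so items are taken in reverse order of offering;
  \<open>bR\<close> is the first state of the layer below. The top layer is filled entirely, but
  \<open>nR\<close> retains only its first state, the initial one.\<close>

definition build_graph :: com where
  "build_graph = block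
    [Assign DR (Add (Reg MR) (Reg MR)), Assign bR (Num 0), Assign xR (Reg DR), Assign jR (Reg kR),
     WhileLess (Num 0) (Reg jR) (block
       [Assign jR (Sub (Reg jR) (Num 1)),
        Assign cR (Get codeA (Get orderA (Reg jR))),
        Assign yR (Num 0),
        build_layer,
        Assign bR (Add (Reg bR) (Reg DR))]),
     Assign nR (Add (Reg bR) (Num 1)), Assign initR (Reg bR)]"

section \<open>Correctness of the layered graph\<close>

context ram_input
begin

text \<open>Division by \<open>2 * M\<close> gives the number of items left, and reduction modulo
  \<open>M\<close> drops both the layer and the recipient flag. A gift to player 1 leads to flag 0,
  a gift to player 2 (\<open>succ2\<close>) to flag 1.\<close>

definition succ1 :: "nat \<Rightarrow> nat" where
  "succ1 x = (let h = x div (2 * M); z = x mod M; c = code (ord (k - h))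
    in (h - 1) * (2 * M) + (if z + c < M then z + c else z))"

definition succ2 :: "nat \<Rightarrow> nat" where
  "succ2 x = (x div (2 * M) - 1) * (2 * M) + M + x mod M"

text \<open>Degrees are fixed at every index, since degree 0 is what marks terminals. State
  \<open>x\<close> owns the slots \<open>2 * x\<close> and \<open>2 * x + 1\<close> of the successor
  array.\<close>

definition built :: "store \<Rightarrow> nat \<Rightarrow> bool" where
  "built s l \<longleftrightarrow> (\<forall>x. arr s degA x = (if 2 * M \<le> x \<and> x < l then 2 else 0))
    \<and> (\<forall>x. 2 * M \<le> x \<and> x < l \<longrightarrow> arr s offA x = 2 * x
        \<and> arr s succA (2 * x) = succ1 x \<and> arr s succA (2 * x + 1) = succ2 x)"

lemma built_reg [simp]: "built (s\<lparr>reg := r\<rparr>) l = built s l"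
  by (simp add: built_def)

text \<open>\<open>y\<close> is the position within layer \<open>Suc i\<close>, and \<open>z\<close>
  is \<open>y\<close> without the recipient flag. In these coordinates no division is left, which is
  how the program computes.\<close>

lemma succ_layer:
  fixes i :: nat
  assumes "y < 2 * M"
  defines "z \<equiv> if y < M then y else y - M" and "x \<equiv> i * (2 * M) + 2 * M + y"
  shows "succ1 x = i * (2 * M) + (if z + code (ord (k - Suc i)) < M then z + code (ord (k - Suc i)) else z)"
    and "succ2 x = i * (2 * M) + M + z"
proof -
  have "x = y + Suc i * (2 * M)" by (simp add: x_def)
  then have "x div (2 * M) = Suc i" using assms(1) by (simp only: div_mult_self1) simp
  moreover have "x mod M = z"
  proof -
    have "x = y + (2 * Suc i) * M" by (simp add: x_def)
    then have "x mod M = y mod M" by (simp only: mod_mult_self1)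
    then show ?thesis using assms(1) by (auto simp: z_def mod_if)
  qed
  ultimately show "succ1 x = i * (2 * M) + (if z + code (ord (k - Suc i)) < M then z + code (ord (k - Suc i)) else z)"
    "succ2 x = i * (2 * M) + M + z"
    by (simp_all add: succ1_def succ2_def Let_def)
qed

lemma wp_build_layer:
  assumes "reg s MR = M" "reg s DR = 2 * M" "reg s yR = 0" "reg s bR = i * (2 * M)"
    and "reg s xR = i * (2 * M) + 2 * M" "reg s cR = code (ord (k - Suc i))"
    and "built s (i * (2 * M) + 2 * M)"
  shows "wp f build_layer s (\<lambda>n s'. n \<le> 200 * M \<and> agree {zR, xR, yR} {degA, offA, succA} s s'
    \<and> reg s' xR = Suc i * (2 * M) + 2 * M \<and> built s' (Suc i * (2 * M) + 2 * M))"
proof -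
  let ?I = "\<lambda>y s'. agree {zR, xR, yR} {degA, offA, succA} s s' \<and> reg s' yR = y
    \<and> reg s' xR = i * (2 * M) + 2 * M + y \<and> built s' (i * (2 * M) + 2 * M + y)"
  have loop: "wp f build_layer s (\<lambda>n s'. n \<le> (2 * M + 1) * (1 + cost (Reg yR) + cost (Reg DR))
      + 2 * M * 60 \<and> ?I (2 * M) s')"
    unfolding build_layer_def
  proof (rule wp_WhileLess[where I = ?I])
    fix y s' assume y: "y < 2 * M" and I: "?I y s'"
    define x where "x = i * (2 * M) + 2 * M + y"
    \<comment> \<open>The slots of an earlier state \<open>a\<close> differ from those of
      \<open>x\<close>, so earlier entries survive.\<close>
    have less: "a + a \<noteq> x + x" "a + a \<noteq> Suc (x + x)" "Suc (a + a) \<noteq> Suc (x + x)" "Suc (a + a) \<noteq> x + x"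
       if "a < x" for a using that by auto
    have bd: "built s' x" and regs: "reg s' xR = x" "reg s' yR = y" using I by (auto simp: x_def)
    have ge: "2 * M \<le> x" by (simp add: x_def)
    show "ev (Reg yR) s' < ev (Reg DR) s' \<and> wp f (block
    [IfLess (Reg yR) (Reg MR) (Assign zR (Reg yR)) (Assign zR (Sub (Reg yR) (Reg MR))),
     Put degA (Reg xR) (Num 2),
     Put offA (Reg xR) (Add (Reg xR) (Reg xR)),
     IfLess (Add (Reg zR) (Reg cR)) (Reg MR)
       (Put succA (Add (Reg xR) (Reg xR)) (Add (Reg bR) (Add (Reg zR) (Reg cR))))
       (Put succA (Add (Reg xR) (Reg xR)) (Add (Reg bR) (Reg zR))),
     Put succA (Add (Add (Reg xR) (Reg xR)) (Num 1)) (Add (Add (Reg bR) (Reg MR)) (Reg zR)),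
     Assign xR (Add (Reg xR) (Num 1)),
     Assign yR (Add (Reg yR) (Num 1))]) s' (\<lambda>n s'. n \<le> 60 \<and> ?I (Suc y) s')"
      using I[THEN conjunct1] y bd regs assms(1-6) succ_layer[OF y, of i, folded x_def] ge less
      unfolding add_Suc_right x_def[symmetric]
      by (auto simp: agree_def built_def less_Suc_eq mult_2)
  qed (use assms in \<open>auto simp: agree_def\<close>)
  have "(2 * M + 1) * (1 + cost (Reg yR) + cost (Reg DR)) + 2 * M * 60 \<le> 200 * M"
    using M_pos by (cases M) auto
  then show ?thesis
    by (intro wp_mono[OF loop]) (auto simp: add_ac)
qed

lemma wp_build_graph:
  assumes "reg s kR = k" "reg s MR = M" "\<And>x. arr s degA x = 0"
    and "\<And>j. j < k \<Longrightarrow> arr s codeA j = code j" "\<And>t. t < k \<Longrightarrow> arr s orderA t = ord t"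
  shows "wp f build_graph s (\<lambda>n s'. n \<le> 300 * ((k + 1) * M)
    \<and> agree {DR, bR, xR, jR, cR, yR, zR, nR, initR} {degA, offA, succA} s s'
    \<and> reg s' nR = k * (2 * M) + 1 \<and> reg s' initR = k * (2 * M)
    \<and> built s' (k * (2 * M) + 2 * M))"
proof -
  \<comment> \<open>After \<open>i\<close> passes layers 1 to \<open>i\<close> are complete; for
    \<open>i = 0\<close> the built range is empty.\<close>
  let ?I = "\<lambda>i s'. agree {DR, bR, xR, jR, cR, yR, zR} {degA, offA, succA} s s'
    \<and> reg s' jR = k - i \<and> reg s' DR = 2 * M \<and> reg s' bR = i * (2 * M)
    \<and> reg s' xR = i * (2 * M) + 2 * M \<and> built s' (i * (2 * M) + 2 * M)"
  let ?s = "s\<lparr>reg := (reg s)(DR := M + M, bR := 0, xR := M + M, jR := k)\<rparr>"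
  let ?body = "block
       [Assign jR (Sub (Reg jR) (Num 1)),
        Assign cR (Get codeA (Get orderA (Reg jR))),
        Assign yR (Num 0),
        build_layer,
        Assign bR (Add (Reg bR) (Reg DR))]"
  have loop: "wp f (WhileLess (Num 0) (Reg jR) ?body) ?s
    (\<lambda>n s'. n \<le> (k + 1) * (1 + cost (Num 0) + cost (Reg jR)) + k * (20 + 200 * M) \<and> ?I k s')"
  proof (rule wp_WhileLess[where I = ?I])
    fix i s' assume i: "i < k" and I: "?I i s'"
    from i have "arr s codeA (arr s orderA (k - Suc i)) = code (ord (k - Suc i))"
      using assms(4,5) ord by simp
    then show "ev (Num 0) s' < ev (Reg jR) s' \<and> wp f ?body s' (\<lambda>n s'. n \<le> 20 + 200 * M \<and> ?I (Suc i) s')"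
      using i I assms(1,2)
      by (simp add: agree_def, intro wp_mono[OF wp_build_layer[of _ i]])
        (simp_all add: agree_def algebra_simps)
  qed (use assms in \<open>auto simp: agree_def built_def\<close>)
  have "20 + ((k + 1) * (1 + cost (Num 0) + cost (Reg jR)) + k * (20 + 200 * M)) \<le> 300 * ((k + 1) * M)"
    using M_pos by (cases M) (auto simp: algebra_simps)
  then show ?thesis unfolding build_graph_def using assms(1,2)
    by (simp, intro wp_mono[OF loop], simp add: agree_def)
qed

end

section \<open>Decoding of codes and tabulation of payoffs\<close>

definition read_digit :: com where
  "read_digit = WhileLess (Get pA (Reg rR)) (Add (Reg zR) (Num 1)) (block
    [Assign zR (Sub (Reg zR) (Get pA (Reg rR))),
     Put vA (Reg rR) (Add (Get vA (Reg rR)) (Num 1))])"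

text \<open>Positions are treated from the highest down; the remainder left in \<open>zR\<close> is
  the number formed by the lower ones.\<close>

definition read_digits :: com where
  "read_digits = WhileLess (Num 0) (Reg rR) (block
    [Assign rR (Sub (Reg rR) (Num 1)), Put vA (Reg rR) (Num 0), read_digit])"

text \<open>Since the codes of both players add up to \<open>M - 1\<close>, the value of player 2 for the code
  \<open>c\<close> belongs to the terminal states of code \<open>M - 1 - c\<close>.\<close>

definition tabulate :: com where
  "tabulate = block [Assign cR (Num 0),
    WhileLess (Reg cR) (Reg MR) (block
      [Assign zR (Reg cR), Assign rR (Reg qR), read_digits,
       Query P1 (Reg cR) vA (Reg qR),
       Query P1 (Add (Reg MR) (Reg cR)) vA (Reg qR),
       Query P2 (Sub (Reg MR) (Add (Reg cR) (Num 1))) vA (Reg qR),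
       Query P2 (Add (Reg MR) (Sub (Reg MR) (Add (Reg cR) (Num 1)))) vA (Reg qR),
       Assign cR (Add (Reg cR) (Num 1))])]"

text \<open>Division by repeated subtraction: the passes count the quotient, and what is left is the
  remainder. The guard \<open>p < z + 1\<close> stands for \<open>p \<le> z\<close>.\<close>

lemma wp_read_digit:
  fixes s :: store
  defines "p \<equiv> arr s pA (reg s rR)"
  assumes "0 < p" "arr s vA (reg s rR) = 0"
  shows "wp f read_digit s (\<lambda>n s'. n \<le> 17 * (reg s zR + 1)
    \<and> agree {zR} {vA} s s' \<and> tab s' = tab s \<and> reg s' zR = reg s zR mod p
    \<and> (\<forall>r. arr s' vA r = (if r = reg s rR then reg s zR div p else arr s vA r)))"
proof -
  let ?m = "reg s zR div p"
  let ?I = "\<lambda>i s'. agree {zR} {vA} s s' \<and> tab s' = tab s \<and> reg s' zR = reg s zR - i * p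
    \<and> (\<forall>r. arr s' vA r = (if r = reg s rR then i else arr s vA r))"
  have loop: "wp f read_digit s (\<lambda>n s'. n
      \<le> (?m + 1) * (1 + cost (Get pA (Reg rR)) + cost (Add (Reg zR) (Num 1))) + ?m * 11 \<and> ?I ?m s')"
    unfolding read_digit_def
  proof (rule wp_WhileLess[where I = ?I])
    fix i s' assume i: "i < ?m" and I: "?I i s'"
    have "Suc i * p \<le> reg s zR"
      using i \<open>0 < p\<close> by (metis Suc_leI less_eq_div_iff_mult_less_eq)
    then have "p < reg s zR - i * p + 1" by simp
    with I show "ev (Get pA (Reg rR)) s' < ev (Add (Reg zR) (Num 1)) s' \<and> wp f (block
      [Assign zR (Sub (Reg zR) (Get pA (Reg rR))),
       Put vA (Reg rR) (Add (Get vA (Reg rR)) (Num 1))]) s' (\<lambda>n s'. n \<le> 11 \<and> ?I (Suc i) s')"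
      by (simp add: agree_def p_def diff_diff_left add_ac)
  next
    fix s' assume I: "?I ?m s'"
    then have "reg s' zR < p"
      using \<open>0 < p\<close> by (simp add: minus_div_mult_eq_mod)
    then show "\<not> ev (Get pA (Reg rR)) s' < ev (Add (Reg zR) (Num 1)) s'"
      using I by (simp add: agree_def p_def)
  qed (use assms in \<open>simp add: agree_def\<close>)
  have "(?m + 1) * (1 + cost (Get pA (Reg rR)) + cost (Add (Reg zR) (Num 1))) + ?m * 11
      \<le> 17 * (reg s zR + 1)"
    by (simp, rule order_trans[OF mult_le_mono2[OF div_le_dividend]]) simp
  then show ?thesis
    by (intro wp_mono[OF loop]) (simp add: minus_div_mult_eq_mod)
qed

context ram_input
begin

abbreviation digits :: "nat \<Rightarrow> nat list" where
  "digits c \<equiv> map (digit wsum c) [0..<q]"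

lemma wp_read_digits:
  assumes "reg s rR = q" "reg s zR = c" "c < M" "\<And>r. r < q \<Longrightarrow> arr s pA r = place wsum r"
  shows "wp f read_digits s (\<lambda>n s'. n \<le> 40 * ((q + 1) * M)
    \<and> agree {zR, rR} {vA} s s' \<and> tab s' = tab s \<and> (\<forall>r<q. arr s' vA r = digit wsum c r))"
proof -
  let ?I = "\<lambda>i s'. agree {zR, rR} {vA} s s' \<and> tab s' = tab s \<and> reg s' rR = q - i
    \<and> reg s' zR = c mod place wsum (q - i)
    \<and> (\<forall>r. q - i \<le> r \<and> r < q \<longrightarrow> arr s' vA r = digit wsum c r)"
  let ?body = "block [Assign rR (Sub (Reg rR) (Num 1)), Put vA (Reg rR) (Num 0), read_digit]"
  have loop: "wp f read_digits s (\<lambda>n s'. n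
      \<le> (q + 1) * (1 + cost (Num 0) + cost (Reg rR)) + q * (10 + 17 * M) \<and> ?I q s')"
    unfolding read_digits_def
  proof (rule wp_WhileLess[where I = ?I])
    fix i s' assume i: "i < q" and I: "?I i s'"
    define r where "r = q - Suc i"
    have r: "r < q" "q - i = Suc r" "q - Suc i = r" using i by (auto simp: r_def)
    \<comment> \<open>The place values divide one another, so remainders may be taken
      successively.\<close>
    have "c mod place wsum (Suc r) mod place wsum r = c mod place wsum r"
      by (simp add: mod_mod_cancel place_dvd)
    moreover have "17 * (c mod place wsum (Suc r) + 1) \<le> 17 * M"
      using le_less_trans[OF mod_less_eq_dividend \<open>c < M\<close>] by (intro mult_le_mono2) (simp add: Suc_le_eq)
    moreover have "r \<le> r' \<and> r' < q \<longleftrightarrow> r' = r \<or> Suc r \<le> r' \<and> r' < q" for r'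
      using r by auto
    ultimately show "ev (Num 0) s' < ev (Reg rR) s'
      \<and> wp f ?body s' (\<lambda>n s'. n \<le> 10 + 17 * M \<and> ?I (Suc i) s')"
      using I assms(4)[OF \<open>r < q\<close>] unfolding r
      by (simp add: agree_def, intro wp_mono[OF wp_read_digit])
        (simp_all add: agree_def digit_def)
  qed (use assms in \<open>simp_all add: agree_def flip: M_def\<close>)
  have "(q + 1) * (1 + cost (Num 0) + cost (Reg rR)) + q * (10 + 17 * M) \<le> 40 * ((q + 1) * M)"
    using M_pos by (cases M) (auto simp: algebra_simps)
  then show ?thesis
    by (intro wp_mono[OF loop]) simp
qed

text \<open>Each payoff appears twice, once for each value of the recipient flag. For player 2,
  \<open>c\<close> is her own code and the entry sits at the complementary one.\<close>

definition tabulated :: "(player \<Rightarrow> nat \<Rightarrow> real) \<Rightarrow> nat \<Rightarrow> bool" where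
  "tabulated T l \<longleftrightarrow> (\<forall>c<l. T P1 c = f P1 (digits c) \<and> T P1 (M + c) = f P1 (digits c)
    \<and> T P2 (M - Suc c) = f P2 (digits c) \<and> T P2 (M + M - Suc c) = f P2 (digits c))"

lemma tabulated_Suc:
  assumes "tabulated T c" "c < M" and v: "\<forall>r<q. v r = digit wsum c r"
  shows "tabulated (T(P1 := (T P1)(c := f P1 (map v [0..<q]), M + c := f P1 (map v [0..<q])),
    P2 := (T P2)(M - Suc c := f P2 (map v [0..<q]), M + M - Suc c := f P2 (map v [0..<q])))) (Suc c)"
    (is "tabulated ?T _")
  unfolding tabulated_def
proof (intro allI impI)
  fix c' assume "c' < Suc c"
  moreover have "map v [0..<q] = digits c" using v by simp
  \<comment> \<open>All codes are below \<open>M\<close>, so truncated subtraction is exact and the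
    new entries miss the old ones.\<close>
  moreover have "M - Suc c' \<noteq> M - Suc c" "M - Suc c' \<noteq> M + M - Suc c"
    "M + M - Suc c' \<noteq> M - Suc c" "M + M - Suc c' \<noteq> M + M - Suc c" "c' \<noteq> M + c" if "c' < c"
    using \<open>c < M\<close> that by auto
  ultimately show "?T P1 c' = f P1 (digits c') \<and> ?T P1 (M + c') = f P1 (digits c')
    \<and> ?T P2 (M - Suc c') = f P2 (digits c') \<and> ?T P2 (M + M - Suc c') = f P2 (digits c')"
    using assms(1,2) by (cases "c' = c") (simp_all add: tabulated_def del: map_eq_conv)
qed

text \<open>There are \<open>M\<close> codes, and decoding one by repeated subtraction takes at most
  \<open>40 * ((q + 1) * M)\<close> steps; this is the source of the factor
  \<open>M * M\<close>.\<close>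

lemma wp_tabulate:
  assumes "reg s MR = M" "reg s qR = q" "\<And>r. r < q \<Longrightarrow> arr s pA r = place wsum r"
  shows "wp f tabulate s (\<lambda>n s'. n \<le> 200 * ((q + 1) * (M * M))
    \<and> agree {cR, zR, rR} {vA} s s' \<and> tabulated (tab s') M)"
proof -
  let ?I = "\<lambda>c s'. agree {cR, zR, rR} {vA} s s' \<and> reg s' cR = c \<and> tabulated (tab s') c"
  let ?s = "s\<lparr>reg := (reg s)(cR := 0)\<rparr>"
  let ?body = "block
      [Assign zR (Reg cR), Assign rR (Reg qR), read_digits,
       Query P1 (Reg cR) vA (Reg qR),
       Query P1 (Add (Reg MR) (Reg cR)) vA (Reg qR),
       Query P2 (Sub (Reg MR) (Add (Reg cR) (Num 1))) vA (Reg qR),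
       Query P2 (Add (Reg MR) (Sub (Reg MR) (Add (Reg cR) (Num 1)))) vA (Reg qR),
       Assign cR (Add (Reg cR) (Num 1))]"
  have loop: "wp f (WhileLess (Reg cR) (Reg MR) ?body) ?s (\<lambda>n s'. n
      \<le> (M + 1) * (1 + cost (Reg cR) + cost (Reg MR)) + M * (60 + 4 * q + 40 * ((q + 1) * M)) \<and> ?I M s')"
  proof (rule wp_WhileLess[where I = ?I])
    fix c s' assume c: "c < M" and I: "?I c s'"
    show "ev (Reg cR) s' < ev (Reg MR) s'
      \<and> wp f ?body s' (\<lambda>n s'. n \<le> 60 + 4 * q + 40 * ((q + 1) * M) \<and> ?I (Suc c) s')"
      using c I assms
      by (simp add: agree_def, intro wp_mono[OF wp_read_digits[of _ c]])
        (simp_all add: agree_def tabulated_Suc)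
  qed (use assms in \<open>simp_all add: agree_def tabulated_def\<close>)
  have "10 + ((M + 1) * (1 + cost (Reg cR) + cost (Reg MR)) + M * (60 + 4 * q + 40 * ((q + 1) * M)))
      \<le> 200 * ((q + 1) * (M * M))"
    using M_pos by (cases M) (auto simp: algebra_simps)
  then show ?thesis unfolding tabulate_def
    by (simp, intro wp_mono[OF loop], simp add: agree_def)
qed

end

section \<open>The complete program and the game that it outputs\<close>

definition construct :: com where
  "construct = block [encode_items, build_graph, tabulate]"

context ram_input
begin

definition constructed :: "store \<Rightarrow> bool" where
  "constructed s \<longleftrightarrow> reg s nR = k * (2 * M) + 1 \<and> reg s initR = k * (2 * M)
    \<and> built s (k * (2 * M) + 2 * M) \<and> tabulated (tab s) M"

lemma wp_construct:
  assumes "reg s kR = k" "reg s qR = q" "\<And>j. arr s codeA j = 0" "\<And>x. arr s degA x = 0"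
    and "\<And>t. t < k \<Longrightarrow> arr s orderA t = ord t"
    and "\<And>j r. j < k \<Longrightarrow> r < q \<Longrightarrow> arr s wA (j * q + r) = wt j r"
  shows "wp f construct s (\<lambda>n s'. n \<le> 600 * (q + 1) * (k + M) ^ 2 \<and> constructed s')"
proof -
  have "k + 1 \<le> k + M" "M \<le> k + M" using M_pos by linarith+
  then have "(k + 1) * M \<le> (k + M) ^ 2" "M * M \<le> (k + M) ^ 2"
    unfolding power2_eq_square by (simp_all only: mult_le_mono)
  moreover from this(1) have "(k + 1) * M \<le> (q + 1) * (k + M) ^ 2"
    by (rule order_trans) simp
  ultimately have *: "(k + 1) * M \<le> (q + 1) * (k + M) ^ 2"
    "(q + 1) * ((k + 1) * M) \<le> (q + 1) * (k + M) ^ 2"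
    "(q + 1) * (M * M) \<le> (q + 1) * (k + M) ^ 2"
    by (simp_all only: mult_le_mono2)
  \<comment> \<open>The three phases contribute \<open>60 + 300 + 200\<close>, which is at most
    \<open>600\<close>.\<close>
  have bound: "n + (n' + n'') \<le> 600 * (q + 1) * (k + M) ^ 2"
    if "n \<le> 60 * ((q + 1) * ((k + 1) * M))" "n' \<le> 300 * ((k + 1) * M)"
      "n'' \<le> 200 * ((q + 1) * (M * M))" for n n' n'' :: nat
    using * that unfolding mult.assoc by linarith
  show ?thesis unfolding construct_def wp_block
  proof (rule wp_mono[OF wp_encode_items[OF assms(1,2,3,6)]]; (elim conjE)?)
    fix n s1 assume 1: "n \<le> 60 * ((q + 1) * ((k + 1) * M))"
      "agree {iR, NR, xR, jR, MR, rR} {codeA, pA} s s1" "reg s1 MR = M"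
      "\<forall>r<q. arr s1 pA r = place wsum r" "\<forall>j<k. arr s1 codeA j = code j"
    then have "wp f build_graph s1 (\<lambda>n s'. n \<le> 300 * ((k + 1) * M)
      \<and> agree {DR, bR, xR, jR, cR, yR, zR, nR, initR} {degA, offA, succA} s1 s'
      \<and> reg s' nR = k * (2 * M) + 1 \<and> reg s' initR = k * (2 * M)
      \<and> built s' (k * (2 * M) + 2 * M))"
      using assms by (intro wp_build_graph) (simp_all add: agree_def)
    then show "wp f build_graph s1 (\<lambda>n' s'. wp f tabulate s' (\<lambda>n'' s''.
      n + (n' + n'') \<le> 600 * (q + 1) * (k + M)\<^sup>2 \<and> constructed s''))"
    proof (rule wp_mono; elim conjE)
      fix n' s2 assume 2: "n' \<le> 300 * ((k + 1) * M)"
        "agree {DR, bR, xR, jR, cR, yR, zR, nR, initR} {degA, offA, succA} s1 s2"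
        "reg s2 nR = k * (2 * M) + 1" "reg s2 initR = k * (2 * M)"
        "built s2 (k * (2 * M) + 2 * M)"
      have "wp f tabulate s2 (\<lambda>n s'. n \<le> 200 * ((q + 1) * (M * M))
        \<and> agree {cR, zR, rR} {vA} s2 s' \<and> tabulated (tab s') M)"
        using 1 2 assms by (intro wp_tabulate) (simp_all add: agree_def)
      then show "wp f tabulate s2 (\<lambda>n'' s''.
        n + (n' + n'') \<le> 600 * (q + 1) * (k + M)\<^sup>2 \<and> constructed s'')"
        using bound 1(1) 2 by (elim wp_mono) (auto simp: constructed_def agree_def built_def)
    qed
  qed
qed

lemma output_game_constructed:
  assumes "constructed s"
  shows "states (output_game s) = {..<k * (2 * M) + 1}"
    and "init (output_game s) = k * (2 * M)"
    and "terminals (output_game s) = {x. x < k * (2 * M) + 1 \<and> x < 2 * M}"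
    and "util (output_game s) = tab s"
    and "2 * M \<le> x \<Longrightarrow> x < k * (2 * M) + 1 \<Longrightarrow> moves (output_game s) x = {succ1 x, succ2 x}"
proof -
  note names = nR_def[symmetric] initR_def[symmetric] degA_def[symmetric] offA_def[symmetric]
    succA_def[symmetric]
  have deg: "arr s degA x = (if 2 * M \<le> x then 2 else 0)" if "x < k * (2 * M) + 1" for x
  proof -
    have "x < k * (2 * M) + 2 * M" using that M_pos by linarith
    then show ?thesis using assms by (simp add: constructed_def built_def)
  qed
  show "states (output_game s) = {..<k * (2 * M) + 1}"
    "init (output_game s) = k * (2 * M)" "util (output_game s) = tab s"
    using assms by (simp_all add: output_game_def names constructed_def)
  show "terminals (output_game s) = {x. x < k * (2 * M) + 1 \<and> x < 2 * M}"
    using assms deg by (auto simp: output_game_def names constructed_def split: if_splits)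
  assume x: "2 * M \<le> x" "x < k * (2 * M) + 1"
  then have "x < k * (2 * M) + 2 * M" using M_pos by linarith
  with x have "arr s offA x = 2 * x" "arr s succA (2 * x) = succ1 x" "arr s succA (2 * x + 1) = succ2 x"
    using assms by (simp_all add: constructed_def built_def)
  moreover have "{h m | m. m < (2::nat)} = {h 0, h 1}" for h :: "nat \<Rightarrow> nat"
    by (auto simp: less_2_cases_iff)
  ultimately show "moves (output_game s) x = {succ1 x, succ2 x}"
    using deg[OF x(2)] x(1) by (simp add: output_game_def names)
qed

text \<open>Both successors lie in the layer below. State numbers thus decrease along moves, which
  gives acyclicity and keeps moves inside the state set.\<close>

lemma succ_less:
  assumes "2 * M \<le> x"
  shows "succ1 x < x" "succ2 x < x"
proof -
  obtain i where i: "x div (2 * M) = Suc i"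
    using assms M_pos by (metis div_greater_zero_iff gr0_implies_Suc mult_pos_pos pos2)
  define y where "y = x mod (2 * M)"
  have y: "y < 2 * M" using M_pos by (simp add: y_def)
  have x: "x = i * (2 * M) + 2 * M + y"
    using div_mult_mod_eq[of x "2 * M"] by (simp add: i y_def)
  show "succ1 x < x" "succ2 x < x"
    unfolding x succ_layer[OF y] using y by auto
qed

lemma game_structure_constructed:
  assumes "constructed s"
  shows "game_structure (output_game s)"
  unfolding game_structure_def output_game_constructed(1-3)[OF assms]
proof (intro conjI ballI)
  have *: "s' < x" if "x \<in> {..<k * (2 * M) + 1} - {x. x < k * (2 * M) + 1 \<and> x < 2 * M}"
    "s' \<in> moves (output_game s) x" for x s'
    using that output_game_constructed(5)[OF assms, of x] succ_less[of x] by auto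
  show "acyclic {(x, s'). x \<in> {..<k * (2 * M) + 1} - {x. x < k * (2 * M) + 1 \<and> x < 2 * M}
      \<and> s' \<in> moves (output_game s) x}"
  proof (rule acyclicI_order[where f = id])
    fix a b assume "(a, b) \<in> {(x, s'). x \<in> {..<k * (2 * M) + 1} - {x. x < k * (2 * M) + 1 \<and> x < 2 * M}
      \<and> s' \<in> moves (output_game s) x}"
    then show "id b < id a" using *[of a b] by simp
  qed
  fix x assume x: "x \<in> {..<k * (2 * M) + 1} - {x. x < k * (2 * M) + 1 \<and> x < 2 * M}"
  show "moves (output_game s) x \<noteq> {}"
    using x output_game_constructed(5)[OF assms, of x] by auto
  show "moves (output_game s) x \<subseteq> {..<k * (2 * M) + 1}"
    using x *[OF x] by fastforce
qed auto

section \<open>Positions of the bargaining as states\<close>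

definition share :: "player \<Rightarrow> player list \<Rightarrow> nat \<Rightarrow> nat" where
  "share i cs r = (\<Sum>t<length cs. if cs ! t = i then wt (ord t) r else 0)"

definition share_code :: "player \<Rightarrow> player list \<Rightarrow> nat" where
  "share_code i cs = (\<Sum>r<q. share i cs r * place wsum r)"

text \<open>\<open>last []\<close> is unspecified, so the test for the empty list is what gives the
  initial state flag 0.\<close>

definition state :: "player list \<Rightarrow> nat" where
  "state cs = (k - length cs) * (2 * M) + (if cs \<noteq> [] \<and> last cs = P2 then M else 0) + share_code P1 cs"

lemma share_code_Nil [simp]: "share_code i [] = 0"
  by (simp add: share_code_def share_def)

lemma share_code_snoc:
  "share_code i (cs @ [m]) = share_code i cs + (if m = i then code (ord (length cs)) else 0)"
proof -
  have "share i (cs @ [m]) r = share i cs r + (if m = i then wt (ord (length cs)) r else 0)" for r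
    by (simp add: share_def nth_append)
  then show ?thesis
    by (simp add: share_code_def code_def sum.distrib add_mult_distrib)
qed

lemma wsum_ord: "(\<Sum>t<k. wt (ord t) r) = wsum r"
  unfolding wsum_def by (rule sum.reindex_bij_betw[OF ord_bij])

lemma share_le:
  assumes "length cs \<le> k"
  shows "share i cs r \<le> wsum r"
proof -
  have "share i cs r \<le> (\<Sum>t<length cs. wt (ord t) r)"
    unfolding share_def by (rule sum_mono) simp
  also have "\<dots> \<le> (\<Sum>t<k. wt (ord t) r)"
    using assms by (intro sum_mono2) auto
  finally show ?thesis by (simp only: wsum_ord)
qed

text \<open>This rules out the overflow case of \<open>succ1\<close> at positions that occur in the
  bargaining.\<close>

lemma share_code_less: "length cs \<le> k \<Longrightarrow> share_code i cs < M"
  unfolding share_code_def M_def by (rule digits_less_place) (rule share_le)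

lemma digits_share_code:
  assumes "length cs \<le> k"
  shows "digits (share_code i cs) = map (share i cs) [0..<q]"
  unfolding share_code_def using assms by (auto intro: digit_sum share_le)

text \<open>Every item goes to exactly one player, so in each position the shares add up to the
  largest digit \<open>wsum r\<close>. No carries arise, and the codes add up to
  \<open>M - 1\<close>.\<close>

lemma share_code_complement:
  assumes "length cs = k"
  shows "share_code P1 cs = M - Suc (share_code P2 cs)"
proof -
  have "share P1 cs r + share P2 cs r = wsum r" for r
  proof -
    have "(if cs ! t = P1 then a else 0) + (if cs ! t = P2 then a else 0) = a" for t and a :: nat
      by (cases "cs ! t") auto
    then show ?thesis
      by (simp add: share_def assms wsum_ord flip: sum.distrib)
  qed
  then have "share_code P1 cs + share_code P2 cs = (\<Sum>r<q. wsum r * place wsum r)"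
    by (simp add: share_code_def flip: sum.distrib add_mult_distrib)
  then show ?thesis using sum_place[of wsum q] by (simp add: M_def)
qed

lemma state_bounds:
  assumes "length cs \<le> k"
  shows "state cs < k * (2 * M) + 1" "state cs < 2 * M \<longleftrightarrow> length cs = k"
proof -
  have c: "share_code P1 cs < M" using assms by (rule share_code_less)
  show "state cs < k * (2 * M) + 1"
  proof (cases cs rule: rev_cases)
    case (snoc cs' m)
    \<comment> \<open>After a round has been played there is room for a full layer below
      \<open>k * (2 * M)\<close>. At the start the code is 0 and the state is exactly
      \<open>k * (2 * M)\<close>.\<close>
    then have "Suc (k - length cs) \<le> k" using assms by simp
    then have "Suc (k - length cs) * (2 * M) \<le> k * (2 * M)" by (rule mult_le_mono1)
    with c show ?thesis by (simp add: state_def)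
  qed (simp add: state_def)
  show "state cs < 2 * M \<longleftrightarrow> length cs = k"
  proof (cases "length cs = k")
    case False
    then obtain d where "k - length cs = Suc d"
      using assms by (metis Suc_diff_Suc le_neq_implies_less)
    then have "2 * M \<le> state cs" by (simp add: state_def)
    with False show ?thesis by simp
  qed (use c in \<open>simp add: state_def\<close>)
qed

text \<open>The two successors differ by the recipient flag: the code after a gift to player 1 stays
  below \<open>M\<close>, so even an item of weight zero gives two states.\<close>

lemma succ_state:
  assumes "length cs < k"
  shows "succ1 (state cs) = state (cs @ [P1])" "succ2 (state cs) = state (cs @ [P2])"
    "state (cs @ [P1]) \<noteq> state (cs @ [P2])"
proof -
  define i where "i = k - Suc (length cs)"
  let ?b = "if cs \<noteq> [] \<and> last cs = P2 then M else 0"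
  let ?c = "share_code P1 cs"
  have i: "k - length cs = Suc i" "k - Suc i = length cs" using assms by (auto simp: i_def)
  \<comment> \<open>The second bound comes from the extended sequence and selects the branch of
    \<open>succ1\<close> without overflow.\<close>
  have c: "?c < M" "?c + code (ord (length cs)) < M"
    using share_code_less[of cs P1] share_code_less[of "cs @ [P1]" P1] assms
    by (auto simp: share_code_snoc)
  have st: "state cs = i * (2 * M) + 2 * M + (?b + ?c)" by (simp add: state_def i)
  have y: "?b + ?c < 2 * M" and z: "(if ?b + ?c < M then ?b + ?c else ?b + ?c - M) = ?c"
    using c by auto
  note succ = succ_layer[OF y, of i, folded st, unfolded z i(2)]
  show "succ1 (state cs) = state (cs @ [P1])" "succ2 (state cs) = state (cs @ [P2])"
    "state (cs @ [P1]) \<noteq> state (cs @ [P2])"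
    using c unfolding succ by (simp_all add: state_def share_code_snoc flip: i_def)
qed

text \<open>A terminal state carries player 1's code; for player 2 the complement turns it into her
  own. Decoding then recovers the weight vector.\<close>

lemma tab_state:
  assumes "constructed s" "length cs = k"
  shows "tab s i (state cs) = f i (map (share i cs) [0..<q])"
proof -
  let ?b = "if cs \<noteq> [] \<and> last cs = P2 then M else 0"
  have c: "share_code i cs < M" for i using assms by (simp add: share_code_less)
  have st: "state cs = ?b + share_code P1 cs" using assms by (simp add: state_def)
  have T: "tab s P1 c = f P1 (digits c)" "tab s P1 (M + c) = f P1 (digits c)"
    "tab s P2 (M - Suc c) = f P2 (digits c)" "tab s P2 (M + M - Suc c) = f P2 (digits c)"
    if "c < M" for c
    using assms(1) that by (simp_all add: constructed_def tabulated_def)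
  have "tab s i (state cs) = f i (digits (share_code i cs))"
  proof (cases i)
    case P1
    then show ?thesis using T[OF c[of P1]] unfolding st by simp
  next
    case P2
    have "M + (M - Suc (share_code P2 cs)) = M + M - Suc (share_code P2 cs)"
      using c[of P2] by simp
    with P2 show ?thesis
      using T[OF c[of P2]] unfolding st share_code_complement[OF assms(2)] by simp
  qed
  then show ?thesis
    using assms(2) digits_share_code[of cs i] by simp
qed

end

section \<open>The program applied to a bargaining\<close>

theorem proposition20:
  shows "\<exists>(p :: com) (c :: nat) (d :: nat).
    \<forall>(F :: 'a bargaining) (q :: nat) (w :: 'a \<Rightarrow> nat \<Rightarrow> nat) (f :: player \<Rightarrow> nat list \<Rightarrow> real)
      (xs :: 'a list).
      ssb F \<and> multi_weight_based F q w f \<and> distinct xs \<and> set xs = items F \<longrightarrow>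
      (let k = card (items F); M = weight_bound F q w in
       \<exists>(n :: nat) (s :: store).
         exec f p (input_store F q w xs) n s \<and>
         n \<le> c * (q + 1) * (k + M) ^ d \<and>
         game_structure (output_game s) \<and>
         equivalent (ssb_process F) (bidding_game (output_game s)) \<and>
         card (states (output_game s)) \<le>
           (if k > 0 \<and> M = 1 then 2 * k + 1 else (k + 1) * M ^ 2))"
proof (rule exI[of _ construct], rule exI[of _ 600], rule exI[of _ 2], intro allI impI, elim conjE)
  fix F :: "'a bargaining" and q w f and xs :: "'a list"
  assume F: "ssb F" and mwb: "multi_weight_based F q w f" and xs: "distinct xs" "set xs = items F"
  let ?os = "item_order F"
  define k where "k = card (items F)"
  define ord where "ord = (\<lambda>t. THE j. j < length xs \<and> xs ! j = ?os ! t)"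
  have len: "length xs = k" "length ?os = k"
    using F xs by (simp_all add: k_def ssb_def flip: distinct_card)
  have os: "distinct ?os" "set ?os = items F" using F by (simp_all add: ssb_def)
  have ord_nth: "ord t < k" "xs ! ord t = ?os ! t" if "t < k" for t
  proof -
    have "?os ! t \<in> set xs" using that os xs len by (metis nth_mem)
    then obtain j where "j < length xs" "xs ! j = ?os ! t" by (auto simp: in_set_conv_nth)
    \<comment> \<open>\<open>xs\<close> lists every item exactly once, which makes the definite
      description in the input well defined.\<close>
    then have "\<exists>!j. j < length xs \<and> xs ! j = ?os ! t"
      using xs(1) by (intro ex1I[of _ j]) (simp, metis nth_eq_iff_index_eq)
    from theI'[OF this] show "ord t < k" "xs ! ord t = ?os ! t" by (simp_all add: ord_def len)
  qed
  have "inj_on ord {..<k}"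
  proof (rule inj_onI)
    fix t t' assume t: "t \<in> {..<k}" "t' \<in> {..<k}" and "ord t = ord t'"
    then have "?os ! t = ?os ! t'" using ord_nth(2)[of t] ord_nth(2)[of t'] by simp
    then show "t = t'" using nth_eq_iff_index_eq[OF os(1)] t len by simp
  qed
  moreover have "ord ` {..<k} \<subseteq> {..<k}" using ord_nth(1) by auto
  ultimately have "bij_betw ord {..<k} {..<k}"
    by (simp add: bij_betw_def endo_inj_surj)
  then interpret ram_input f k q "\<lambda>j. w (xs ! j)" ord by unfold_locales
  have "wsum r = (\<Sum>j\<in>items F. w j r)" for r
    unfolding wsum_def using bij_betw_nth[OF xs(1), of "{..<k}" "items F"] xs(2) len
    by (intro sum.reindex_bij_betw) simp
  then have M: "weight_bound F q w = M"
    by (simp add: weight_bound_def M_def place_def)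
  let ?s = "input_store F q w xs"
  note names = kR_def qR_def wA_def orderA_def codeA_def degA_def
  have "wp f construct ?s (\<lambda>n s'. n \<le> 600 * (q + 1) * (k + M) ^ 2 \<and> constructed s')"
  proof (rule wp_construct)
    fix j r assume "j < k" "r < q"
    \<comment> \<open>The index lies inside the stored matrix, and \<open>r < q\<close> lets
      \<open>div\<close> and \<open>mod\<close> recover row and column.\<close>
    then have "j * q + r < Suc j * q" by simp
    also have "\<dots> \<le> k * q" using \<open>j < k\<close> by (intro mult_le_mono1) simp
    finally show "arr ?s wA (j * q + r) = w (xs ! j) r"
      using \<open>r < q\<close> by (simp add: input_store_def wA_def flip: k_def)
  qed (simp_all add: input_store_def names ord_def flip: k_def)
  then obtain n s where exec: "exec f construct ?s n s" "n \<le> 600 * (q + 1) * (k + M) ^ 2"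
    and s: "constructed s"
    unfolding wp_def by blast
  have length: "length cs \<le> k" if "feasible (ssb_process F) cs" for cs
    using that by induction (auto simp: ssb_process_def len split: if_splits)
  have "equivalent (ssb_process F) (bidding_game (output_game s))"
  proof (rule equivalent_bidding_game[where st = state, OF _ _ _ length])
    show "state [] = init (output_game s)"
      by (simp add: state_def output_game_constructed[OF s])
  next
    fix cs assume "choices (ssb_process F) cs \<noteq> {}"
    then have "length cs < k" "choices (ssb_process F) cs = UNIV"
      by (simp_all add: ssb_process_def len split: if_splits)
    moreover have "UNIV = {P1, P2}" by (auto intro: player.exhaust)
    ultimately have "length cs < k" "choices (ssb_process F) cs = {P1, P2}" by simp_all
    then show "state cs \<notin> terminals (output_game s) \<and> bij_betw (\<lambda>m. state (cs @ [m]))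
        (choices (ssb_process F) cs) (moves (output_game s) (state cs))"
      using state_bounds[of cs] succ_state[of cs] output_game_constructed(3,5)[OF s]
      by (auto simp: bij_betw_def)
  next
    fix cs i assume "feasible (ssb_process F) cs" "choices (ssb_process F) cs = {}"
    then have cs: "length cs = k"
      using length[of cs] by (simp add: ssb_process_def len split: if_splits)
    have allot: "allotment F cs i = (!) ?os ` {t \<in> {..<k}. cs ! t = i}"
      by (auto simp: allotment_def len)
    have "(\<Sum>j\<in>allotment F cs i. w j r) = share i cs r" for r
    proof -
      have "(\<Sum>j\<in>allotment F cs i. w j r) = (\<Sum>t\<in>{t \<in> {..<k}. cs ! t = i}. w (?os ! t) r)"
        unfolding allot using os(1) len by (subst sum.reindex) (auto intro: inj_on_nth)
      also have "\<dots> = share i cs r"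
        unfolding share_def cs by (subst sum.inter_filter) (auto simp: ord_nth intro!: sum.cong)
      finally show ?thesis .
    qed
    moreover have "allotment F cs i \<subseteq> items F"
      unfolding allot os(2)[symmetric] using len(2) by (intro image_subsetI nth_mem) simp
    then have "valuation F i (allotment F cs i) = f i (weight_vector q w (allotment F cs i))"
      using mwb by (simp add: multi_weight_based_def)
    ultimately have "valuation F i (allotment F cs i) = f i (map (share i cs) [0..<q])"
      by (simp add: weight_vector_def)
    then show "state cs \<in> terminals (output_game s)
        \<and> util (output_game s) i (state cs) = payoff (ssb_process F) i cs"
      using state_bounds[of cs] cs tab_state[OF s cs, of i]
      by (simp add: output_game_constructed[OF s] ssb_process_def)
  qed
  \<comment> \<open>The count consists of \<open>k\<close> layers of \<open>2 * M\<close> states and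
    the initial state. For \<open>M\<close> at least 2 the bound follows from
    \<open>2 * M \<le> M * M\<close>.\<close>
  moreover have "k * (2 * M) + 1 \<le> (if k > 0 \<and> M = 1 then 2 * k + 1 else (k + 1) * M ^ 2)"
  proof (cases "k > 0 \<and> M \<noteq> 1")
    case True
    then have "M \<noteq> 1" by simp
    then have "2 \<le> M" using M_pos by linarith
    then have "2 * M \<le> M * M" "1 \<le> M * M"
      using mult_le_mono[of 1 M 1 M] by simp_all
    then have "k * (2 * M) + 1 \<le> k * (M * M) + M * M" by (intro add_mono mult_le_mono) auto
    with True show ?thesis by (simp add: power2_eq_square)
  next
    \<comment> \<open>Either \<open>k = 0\<close> and a single state remains, or
      \<open>M = 1\<close> and the count is exactly \<open>2 * k + 1\<close>.\<close>
    case False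
    moreover have "1 \<le> M ^ 2" using one_le_power[of M 2] M_pos by linarith
    ultimately show ?thesis by auto
  qed
  ultimately show "let k = card (items F); M = weight_bound F q w in \<exists>n s.
      exec f construct ?s n s \<and> n \<le> 600 * (q + 1) * (k + M) ^ 2 \<and>
      game_structure (output_game s) \<and>
      equivalent (ssb_process F) (bidding_game (output_game s)) \<and>
      card (states (output_game s)) \<le>
        (if k > 0 \<and> M = 1 then 2 * k + 1 else (k + 1) * M ^ 2)"
    unfolding M Let_def k_def[symmetric] using exec game_structure_constructed[OF s]
    by (intro exI[of _ n] exI[of _ s] conjI) (simp_all only: output_game_constructed(1)[OF s] card_lessThan)
qed

end
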